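(* Let $\alpha\colon\mathcal{C}\to\mathcal{D}$ be the isomorphism of commutative $C^\ast$-algebras determined by $\alpha(A_v)=\sigma^z_{e_v}$ for $v\in V$, where $e_v$ is the upper (vertical) edge of the star at $v$ (the vertical edge having $v$ as its lower endpoint), and $\alpha(B_{\tilde v})=\sigma^z_{e_{\tilde v}}$ for $\tilde v\in\tilde V$, where $e_{\tilde v}$ is the upper (horizontal) edge of the face $\tilde v$. Then $\alpha$ does not lift to an automorphism of $\mathcal{A}$, i.e. there is no $\ast$-automorphism of $\mathcal{A}$ whose restriction to $\mathcal{C}$ is $\alpha$.
   Context: Let $\mathcal{L}$ be the infinite planar square lattice (vertex set $V=\mathbb{Z}^2$, nearest-neighbour horizontal and vertical edges), with set of unoriented edges $E$. Let $\tilde V$ be the set of faces of $\mathcal{L}$; for $\tilde v\in\tilde V$ write $e\in\tilde v$ if $e\in E$ is one of the four edges bounding the face $\tilde v$; for $v\in V$ write $e\ni v$ if $v$ is an endpoint of $e$. Each edge $e$ carries $\mathcal{A}_e=M_2(\mathbb{C})$, with Pauli matrices $\sigma^x_e,\sigma^z_e\in\mathcal{A}_e$. For finite $\Lambda\subset E$, $\mathcal{A}_\Lambda=\bigotimes_{e\in\Lambda}\mathcal{A}_e$, with the natural inclusions $\mathcal{A}_{\Lambda'}\subset\mathcal{A}_\Lambda$ for $\Lambda'\subset\Lambda$; $\mathcal{A}$ is the $C^\ast$-completion of $\bigcup_\Lambda\mathcal{A}_\Lambda$ (so $\mathcal{A}\simeq M_{2^\infty}$). The star and face operators are $A_v=\prod_{e\ni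 v}\sigma^x_e$ and $B_{\tilde v}=\prod_{e\in\tilde v}\sigma^z_e$; they are pairwise commuting self-adjoint unitaries. Set $\mathcal{C}=C^\ast\{A_v,B_{\tilde v}\mid v\in V,\ \tilde v\in\tilde V\}\subset\mathcal{A}$ and $\mathcal{D}=C^\ast\{\sigma^z_e\mid e\in E\}\subset\mathcal{A}$. *)

theory Defs
  imports "HOL-Analysis.Analysis"
begin

section \<open>\<open>C\<^sup>*\<close>-algebras\<close>

text \<open>A unital *-algebra over the complex numbers with a (not necessarily complete) \<open>C\<^sup>*\<close>-norm;
  the real scalar multiplication of the library classes is the restriction of the complex one.\<close>

class pre_cstar_algebra = real_normed_algebra_1 +
  fixes scaleC :: "complex \<Rightarrow> 'a \<Rightarrow> 'a" (infixr "*\<^sub>C" 75)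
    and adj :: "'a \<Rightarrow> 'a"
  assumes scaleC_add_right: "c *\<^sub>C (x + y) = c *\<^sub>C x + c *\<^sub>C y"
    and scaleC_add_left: "(c + d) *\<^sub>C x = c *\<^sub>C x + d *\<^sub>C x"
    and scaleC_scaleC: "c *\<^sub>C d *\<^sub>C x = (c * d) *\<^sub>C x"
    and scaleR_scaleC: "r *\<^sub>R x = complex_of_real r *\<^sub>C x"
    and mult_scaleC_left: "(c *\<^sub>C x) * y = c *\<^sub>C (x * y)"
    and mult_scaleC_right: "x * (c *\<^sub>C y) = c *\<^sub>C (x * y)"
    and norm_scaleC: "norm (c *\<^sub>C x) = cmod c * norm x"
    and adj_adj: "adj (adj x) = x"
    and adj_add: "adj (x + y) = adj x + adj y"
    and adj_scaleC: "adj (c *\<^sub>C x) = cnj c *\<^sub>C adj x"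
    and adj_mult: "adj (x * y) = adj y * adj x"
    and norm_adj_mult_self: "norm (adj x * x) = (norm x)\<^sup>2"

class cstar_algebra = pre_cstar_algebra + complete_space

lemma scaleC_one: "1 *\<^sub>C x = (x :: 'a :: pre_cstar_algebra)"
  using scaleR_scaleC[of 1 x] by simp

lemma scaleC_minus1: "(- 1) *\<^sub>C x = - (x :: 'a :: pre_cstar_algebra)"
proof -
  have "(- 1) *\<^sub>C x = (- 1 :: real) *\<^sub>R x"
    by (simp add: scaleR_scaleC)
  then show ?thesis by simp
qed

lemma adj_minus: "adj (- x) = - adj (x :: 'a :: pre_cstar_algebra)"
  by (metis adj_scaleC scaleC_minus1 complex_cnj_minus complex_cnj_one)

lemma adj_diff: "adj (x - y) = adj x - adj (y :: 'a :: pre_cstar_algebra)"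
  by (metis adj_add adj_minus diff_conv_add_uminus)

lemma scaleC_diff_right: "c *\<^sub>C (x - y) = c *\<^sub>C x - c *\<^sub>C (y :: 'a :: pre_cstar_algebra)"
  by (metis scaleC_add_right add_diff_cancel diff_add_cancel)

lemma norm_adj: "norm (adj x) = norm (x :: 'a :: pre_cstar_algebra)"
proof -
  have le: "norm y \<le> norm (adj y)" for y :: 'a
  proof (cases "norm y = 0")
    case False
    have "norm y * norm y \<le> norm (adj y) * norm y"
      using norm_mult_ineq[of "adj y" y] by (simp add: norm_adj_mult_self power2_eq_square)
    with False show ?thesis by (metis mult_right_le_imp_le norm_ge_zero order_le_less)
  qed auto
  show ?thesis
    using le[of x] le[of "adj x"] by (simp add: adj_adj)
qed

definition star_subalgebra :: "'a :: pre_cstar_algebra set \<Rightarrow> bool" where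
  "star_subalgebra B \<longleftrightarrow> 0 \<in> B \<and> (\<forall>x\<in>B. \<forall>y\<in>B. x + y \<in> B \<and> x * y \<in> B) \<and>
     (\<forall>c. \<forall>x\<in>B. c *\<^sub>C x \<in> B) \<and> (\<forall>x\<in>B. adj x \<in> B)"

definition generated_cstar :: "'a :: cstar_algebra set \<Rightarrow> 'a set" where
  "generated_cstar S = \<Inter> {B. S \<subseteq> B \<and> star_subalgebra B \<and> closed B}"

definition star_isomorphism :: "'a :: pre_cstar_algebra set \<Rightarrow> 'b :: pre_cstar_algebra set \<Rightarrow> ('a \<Rightarrow> 'b) \<Rightarrow> bool" where
  "star_isomorphism B B' f \<longleftrightarrow> bij_betw f B B' \<and>
     (\<forall>x\<in>B. \<forall>y\<in>B. f (x + y) = f x + f y \<and> f (x * y) = f x * f y) \<and>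
     (\<forall>c. \<forall>x\<in>B. f (c *\<^sub>C x) = c *\<^sub>C f x) \<and> (\<forall>x\<in>B. f (adj x) = adj (f x))"

abbreviation star_automorphism :: "('a :: pre_cstar_algebra \<Rightarrow> 'a) \<Rightarrow> bool" where
  "star_automorphism \<equiv> star_isomorphism UNIV UNIV"

section \<open>Local operators\<close>

text \<open>We have a qubit at each element of \<open>'e\<close>.  A basis configuration is the set of those sites
  whose spin is down, so \<open>\<A>\<^sub>\<Lambda> = \<Otimes>\<^bsub>e \<in> \<Lambda>\<^esub> M\<^sub>2(\<complex>)\<close> is the algebra of matrices
  \<open>M\<close> indexed by \<open>Pow \<Lambda>\<close>.  The kernel \<open>amplify \<Lambda> M\<close> on the set of all configurations is the
  matrix of \<open>M \<otimes> 1\<close>, with the identity on the sites outside \<open>\<Lambda>\<close>.  It is unchanged if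
  \<open>M \<in> \<A>\<^sub>\<Lambda>\<close> is replaced by its image in \<open>\<A>\<^bsub>\<Lambda>'\<^esub>\<close> for \<open>\<Lambda> \<subseteq> \<Lambda>'\<close>, so that the
  kernels of this form, for all finite \<open>\<Lambda>\<close>, make up \<open>\<Union>\<^sub>\<Lambda> \<A>\<^sub>\<Lambda>\<close>.\<close>

definition amplify :: "'e set \<Rightarrow> ('e set \<Rightarrow> 'e set \<Rightarrow> complex) \<Rightarrow> 'e set \<Rightarrow> 'e set \<Rightarrow> complex" where
  "amplify \<Lambda> M s t = (if s - \<Lambda> = t - \<Lambda> then M (s \<inter> \<Lambda>) (t \<inter> \<Lambda>) else 0)"

text \<open>\<open>on_sites \<Lambda> K\<close> means \<open>K \<in> \<A>\<^sub>\<Lambda>\<close>.\<close>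

definition on_sites :: "'e set \<Rightarrow> ('e set \<Rightarrow> 'e set \<Rightarrow> complex) \<Rightarrow> bool" where
  "on_sites \<Lambda> K \<longleftrightarrow> (\<exists>M. K = amplify \<Lambda> M)"

typedef 'e local_op = "{K :: 'e set \<Rightarrow> 'e set \<Rightarrow> complex. \<exists>\<Lambda>. finite \<Lambda> \<and> on_sites \<Lambda> K}"
  morphisms kernel Abs_local_op
  unfolding on_sites_def by blast

setup_lifting type_definition_local_op

lemma on_sitesI:
  assumes "\<And>s t. s - \<Lambda> \<noteq> t - \<Lambda> \<Longrightarrow> K s t = 0"
    and "\<And>s t. s - \<Lambda> = t - \<Lambda> \<Longrightarrow> K s t = K (s \<inter> \<Lambda>) (t \<inter> \<Lambda>)"
  shows "on_sites \<Lambda> K"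
  unfolding on_sites_def
  by (rule exI[of _ K], intro ext) (use assms in \<open>auto simp: amplify_def\<close>)

lemma on_sites_amplify: "on_sites \<Lambda> (amplify \<Lambda> M)"
  by (auto simp: on_sites_def)

lemma on_sites_off: "on_sites \<Lambda> K \<Longrightarrow> s - \<Lambda> \<noteq> t - \<Lambda> \<Longrightarrow> K s t = 0"
  unfolding on_sites_def amplify_def by (elim exE) simp

lemma on_sites_on: "on_sites \<Lambda> K \<Longrightarrow> s - \<Lambda> = t - \<Lambda> \<Longrightarrow> K s t = K (s \<inter> \<Lambda>) (t \<inter> \<Lambda>)"
proof -
  have "s \<inter> \<Lambda> - \<Lambda> = {}" "t \<inter> \<Lambda> - \<Lambda> = {}" by auto
  then show "on_sites \<Lambda> K \<Longrightarrow> s - \<Lambda> = t - \<Lambda> \<Longrightarrow> K s t = K (s \<inter> \<Lambda>) (t \<inter> \<Lambda>)"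
    by (auto simp: on_sites_def amplify_def)
qed

lemma on_sites_mono:
  assumes "on_sites \<Lambda> K" "\<Lambda> \<subseteq> \<Lambda>'"
  shows "on_sites \<Lambda>' K"
proof (rule on_sitesI)
  fix s t
  assume "s - \<Lambda>' \<noteq> t - \<Lambda>'"
  then have "s - \<Lambda> \<noteq> t - \<Lambda>" using assms(2) by blast
  then show "K s t = 0" by (rule on_sites_off[OF assms(1)])
next
  fix s t
  assume st: "s - \<Lambda>' = t - \<Lambda>'"
  show "K s t = K (s \<inter> \<Lambda>') (t \<inter> \<Lambda>')"
  proof (cases "s - \<Lambda> = t - \<Lambda>")
    case True
    then have "s \<inter> \<Lambda>' - \<Lambda> = t \<inter> \<Lambda>' - \<Lambda>" by blast
    moreover have "s \<inter> \<Lambda>' \<inter> \<Lambda> = s \<inter> \<Lambda>" "t \<inter> \<Lambda>' \<inter> \<Lambda> = t \<inter> \<Lambda>" using assms(2) by auto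
    ultimately show ?thesis
      using on_sites_on[OF assms(1) True] on_sites_on[OF assms(1), of "s \<inter> \<Lambda>'" "t \<inter> \<Lambda>'"] by simp
  next
    case False
    with st have "s \<inter> \<Lambda>' - \<Lambda> \<noteq> t \<inter> \<Lambda>' - \<Lambda>" by blast
    with False show ?thesis by (simp add: on_sites_off[OF assms(1)])
  qed
qed

lemma on_sites_common:
  assumes "\<exists>\<Lambda>. finite \<Lambda> \<and> on_sites \<Lambda> K" "\<exists>\<Lambda>. finite \<Lambda> \<and> on_sites \<Lambda> L"
  obtains \<Lambda> where "finite \<Lambda>" "on_sites \<Lambda> K" "on_sites \<Lambda> L"
  using assms by (meson finite_UnI on_sites_mono sup_ge1 sup_ge2)

lemma on_sites_ex2:
  assumes "\<exists>\<Lambda>. finite \<Lambda> \<and> on_sites \<Lambda> K" "\<exists>\<Lambda>. finite \<Lambda> \<and> on_sites \<Lambda> L"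
    and "\<And>\<Lambda>. finite \<Lambda> \<Longrightarrow> on_sites \<Lambda> K \<Longrightarrow> on_sites \<Lambda> L \<Longrightarrow> on_sites \<Lambda> J"
  shows "\<exists>\<Lambda>. finite \<Lambda> \<and> on_sites \<Lambda> J"
  using on_sites_common[OF assms(1,2)] assms(3) by metis

definition kone :: "'e set \<Rightarrow> 'e set \<Rightarrow> complex" where
  "kone s t = (if s = t then 1 else 0)"

definition kadj :: "('e set \<Rightarrow> 'e set \<Rightarrow> complex) \<Rightarrow> 'e set \<Rightarrow> 'e set \<Rightarrow> complex" where
  "kadj K s t = cnj (K t s)"

definition kmult :: "('e set \<Rightarrow> 'e set \<Rightarrow> complex) \<Rightarrow> ('e set \<Rightarrow> 'e set \<Rightarrow> complex) \<Rightarrow> 'e set \<Rightarrow> 'e set \<Rightarrow> complex" where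
  "kmult K L s t = (\<Sum>u | K s u \<noteq> 0. K s u * L u t)"

definition nbhd :: "'e set \<Rightarrow> 'e set \<Rightarrow> 'e set set" where
  "nbhd \<Lambda> s = {u. u - \<Lambda> = s - \<Lambda>}"

lemma nbhd_bij: "bij_betw (\<lambda>r. (s - \<Lambda>) \<union> r) (Pow \<Lambda>) (nbhd \<Lambda> s)"
  by (rule bij_betwI[where g = "\<lambda>u. u \<inter> \<Lambda>"]) (auto simp: nbhd_def)

lemma finite_nbhd: "finite \<Lambda> \<Longrightarrow> finite (nbhd \<Lambda> s)"
  using bij_betw_finite[OF nbhd_bij[of s \<Lambda>]] by simp

lemma card_nbhd: "finite \<Lambda> \<Longrightarrow> card (nbhd \<Lambda> s) = card (Pow \<Lambda>)"
  using bij_betw_same_card[OF nbhd_bij[of s \<Lambda>]] by simp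

lemma row_subset:
  assumes "on_sites \<Lambda> K"
  shows "{u. K s u \<noteq> 0} \<subseteq> nbhd \<Lambda> s"
proof
  fix u assume "u \<in> {u. K s u \<noteq> 0}"
  then have "s - \<Lambda> = u - \<Lambda>" using on_sites_off[OF assms, of s u] by blast
  then show "u \<in> nbhd \<Lambda> s" by (simp add: nbhd_def)
qed

lemma col_subset:
  assumes "on_sites \<Lambda> K"
  shows "{u. K u s \<noteq> 0} \<subseteq> nbhd \<Lambda> s"
proof
  fix u assume "u \<in> {u. K u s \<noteq> 0}"
  then have "u - \<Lambda> = s - \<Lambda>" using on_sites_off[OF assms, of u s] by blast
  then show "u \<in> nbhd \<Lambda> s" by (simp add: nbhd_def)
qed

lemma kmult_eq_sum:
  assumes "finite A" "{u. K s u \<noteq> 0} \<subseteq> A"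
  shows "kmult K L s t = (\<Sum>u\<in>A. K s u * L u t)"
  unfolding kmult_def by (rule sum.mono_neutral_left) (use assms in auto)

lemma kmult_eq_amplify:
  assumes "finite \<Lambda>" "on_sites \<Lambda> K" "on_sites \<Lambda> L"
  shows "kmult K L = amplify \<Lambda> (\<lambda>a b. \<Sum>r\<in>Pow \<Lambda>. K a r * L r b)"
proof (intro ext)
  fix s t
  have eq: "kmult K L s t = (\<Sum>u\<in>nbhd \<Lambda> s. K s u * L u t)"
    by (rule kmult_eq_sum) (use assms finite_nbhd row_subset[OF assms(2)] in simp_all)
  show "kmult K L s t = amplify \<Lambda> (\<lambda>a b. \<Sum>r\<in>Pow \<Lambda>. K a r * L r b) s t"
  proof (cases "s - \<Lambda> = t - \<Lambda>")
    case True
    have "kmult K L s t = (\<Sum>r\<in>Pow \<Lambda>. K s ((s - \<Lambda>) \<union> r) * L ((s - \<Lambda>) \<union> r) t)"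
      unfolding eq by (rule sum.reindex_bij_betw[symmetric, OF nbhd_bij])
    also have "\<dots> = (\<Sum>r\<in>Pow \<Lambda>. K (s \<inter> \<Lambda>) r * L r (t \<inter> \<Lambda>))"
    proof (rule sum.cong)
      fix r assume "r \<in> Pow \<Lambda>"
      then have r: "((s - \<Lambda>) \<union> r) - \<Lambda> = s - \<Lambda>" "((s - \<Lambda>) \<union> r) \<inter> \<Lambda> = r" by auto
      show "K s ((s - \<Lambda>) \<union> r) * L ((s - \<Lambda>) \<union> r) t = K (s \<inter> \<Lambda>) r * L r (t \<inter> \<Lambda>)"
        using on_sites_on[OF assms(2), of s "(s - \<Lambda>) \<union> r"]
          on_sites_on[OF assms(3), of "(s - \<Lambda>) \<union> r" t] r True by simp
    qed simp
    finally show ?thesis using True by (simp add: amplify_def)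
  next
    case False
    have "K s u * L u t = 0" if "u \<in> nbhd \<Lambda> s" for u
      using that False on_sites_off[OF assms(3), of u t] by (auto simp: nbhd_def)
    then have "(\<Sum>u\<in>nbhd \<Lambda> s. K s u * L u t) = 0"
      by (intro sum.neutral) blast
    with False show ?thesis by (simp add: eq amplify_def)
  qed
qed

lemma on_sites_kmult: "finite \<Lambda> \<Longrightarrow> on_sites \<Lambda> K \<Longrightarrow> on_sites \<Lambda> L \<Longrightarrow> on_sites \<Lambda> (kmult K L)"
  by (simp add: kmult_eq_amplify on_sites_amplify)

lemma kmult_assoc:
  assumes "finite \<Lambda>" "on_sites \<Lambda> K" "on_sites \<Lambda> L" "on_sites \<Lambda> M"
  shows "kmult (kmult K L) M = kmult K (kmult L M)"
proof (intro ext)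
  fix s t
  let ?N = "nbhd \<Lambda> s"
  have N: "finite ?N" by (rule finite_nbhd[OF assms(1)])
  note KL = on_sites_kmult[OF assms(1-3)]
  have "kmult (kmult K L) M s t = (\<Sum>w\<in>?N. \<Sum>u\<in>?N. K s u * L u w * M w t)"
    by (simp only: kmult_eq_sum[where K = "kmult K L" and s = s, OF N row_subset[OF KL]]
        kmult_eq_sum[where K = K and s = s, OF N row_subset[OF assms(2)]] sum_distrib_right)
  also have "\<dots> = (\<Sum>u\<in>?N. \<Sum>w\<in>?N. K s u * L u w * M w t)"
    by (rule sum.swap)
  also have "\<dots> = (\<Sum>u\<in>?N. K s u * kmult L M u t)"
  proof (rule sum.cong)
    fix u assume "u \<in> ?N"
    then have "nbhd \<Lambda> u = ?N" by (auto simp: nbhd_def)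
    then have "{w. L u w \<noteq> 0} \<subseteq> ?N" using row_subset[OF assms(3), of u] by simp
    from kmult_eq_sum[where K = L and s = u and L = M and t = t, OF N this]
    show "(\<Sum>w\<in>?N. K s u * L u w * M w t) = K s u * kmult L M u t"
      by (simp only: sum_distrib_left mult.assoc)
  qed simp
  also have "\<dots> = kmult K (kmult L M) s t"
    by (rule kmult_eq_sum[where K = K and s = s, OF N row_subset[OF assms(2)], symmetric])
  finally show "kmult (kmult K L) M s t = kmult K (kmult L M) s t" .
qed

lemma on_sites_kone: "on_sites {} kone"
  by (rule on_sitesI) (auto simp: kone_def)

lemma on_sites_zero: "on_sites {} (\<lambda>s t. 0)"
  by (rule on_sitesI) auto

lemma on_sites_pointwise:
  assumes "on_sites \<Lambda> K" "on_sites \<Lambda> L" "f 0 0 = 0"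
  shows "on_sites \<Lambda> (\<lambda>s t. f (K s t) (L s t))"
proof (rule on_sitesI)
  fix s t assume "s - \<Lambda> \<noteq> t - \<Lambda>"
  then show "f (K s t) (L s t) = 0"
    by (simp add: on_sites_off[OF assms(1)] on_sites_off[OF assms(2)] assms(3))
next
  fix s t assume st: "s - \<Lambda> = t - \<Lambda>"
  show "f (K s t) (L s t) = f (K (s \<inter> \<Lambda>) (t \<inter> \<Lambda>)) (L (s \<inter> \<Lambda>) (t \<inter> \<Lambda>))"
    by (rule arg_cong2[OF on_sites_on[OF assms(1) st] on_sites_on[OF assms(2) st]])
qed

lemma on_sites_add: "on_sites \<Lambda> K \<Longrightarrow> on_sites \<Lambda> L \<Longrightarrow> on_sites \<Lambda> (\<lambda>s t. K s t + L s t)"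
  by (rule on_sites_pointwise) simp_all

lemma on_sites_scale: "on_sites \<Lambda> K \<Longrightarrow> on_sites \<Lambda> (\<lambda>s t. c * K s t)"
  by (rule on_sites_pointwise[of \<Lambda> K K "\<lambda>x y. c * x"]) simp_all

lemma on_sites_kadj:
  assumes "on_sites \<Lambda> K"
  shows "on_sites \<Lambda> (kadj K)"
proof (rule on_sitesI)
  fix s t assume "s - \<Lambda> \<noteq> t - \<Lambda>"
  then have "t - \<Lambda> \<noteq> s - \<Lambda>" by simp
  then show "kadj K s t = 0" by (simp add: kadj_def on_sites_off[OF assms])
next
  fix s t assume "s - \<Lambda> = t - \<Lambda>"
  then have "t - \<Lambda> = s - \<Lambda>" by simp
  then show "kadj K s t = kadj K (s \<inter> \<Lambda>) (t \<inter> \<Lambda>)"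
    using on_sites_on[OF assms] by (simp only: kadj_def)
qed

text \<open>The norm is the operator norm for the action on finitely supported vectors in
  \<open>\<ell>\<^sup>2\<close> of the set of configurations; for a kernel in \<open>\<A>\<^sub>\<Lambda>\<close> this is a direct sum of copies of the
  action of the matrix on \<open>\<complex>\<^bsup>Pow \<Lambda>\<^esup>\<close>.\<close>

definition supp :: "('c \<Rightarrow> complex) \<Rightarrow> 'c set" where
  "supp \<psi> = {s. \<psi> s \<noteq> 0}"

definition vnorm :: "('c \<Rightarrow> complex) \<Rightarrow> real" where
  "vnorm \<psi> = L2_set (\<lambda>s. cmod (\<psi> s)) (supp \<psi>)"

definition kapp :: "('c \<Rightarrow> 'c \<Rightarrow> complex) \<Rightarrow> ('c \<Rightarrow> complex) \<Rightarrow> 'c \<Rightarrow> complex" where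
  "kapp K \<psi> s = (\<Sum>t\<in>supp \<psi>. K s t * \<psi> t)"

definition knorm :: "('c \<Rightarrow> 'c \<Rightarrow> complex) \<Rightarrow> real" where
  "knorm K = (SUP \<psi>\<in>{\<psi>. finite (supp \<psi>) \<and> vnorm \<psi> = 1}. vnorm (kapp K \<psi>))"

lemma vnorm_eq:
  assumes "finite A" "supp \<psi> \<subseteq> A"
  shows "vnorm \<psi> = L2_set (\<lambda>s. cmod (\<psi> s)) A"
  unfolding vnorm_def L2_set_def
  by (rule arg_cong[where f = sqrt], rule sum.mono_neutral_left) (use assms in \<open>auto simp: supp_def\<close>)

lemma kapp_eq:
  assumes "finite A" "supp \<psi> \<subseteq> A"
  shows "kapp K \<psi> s = (\<Sum>t\<in>A. K s t * \<psi> t)"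
  unfolding kapp_def by (rule sum.mono_neutral_left) (use assms in \<open>auto simp: supp_def\<close>)

lemma vnorm_nonneg: "0 \<le> vnorm \<psi>"
  by (simp add: vnorm_def)

lemma vnorm_eq_0: "finite (supp \<psi>) \<Longrightarrow> vnorm \<psi> = 0 \<longleftrightarrow> (\<forall>s. \<psi> s = 0)"
  by (auto simp: vnorm_def L2_set_eq_0_iff supp_def)

lemma vnorm_scale:
  assumes "finite (supp \<psi>)"
  shows "vnorm (\<lambda>s. c * \<psi> s) = cmod c * vnorm \<psi>"
proof -
  have "vnorm (\<lambda>s. c * \<psi> s) = L2_set (\<lambda>s. cmod (c * \<psi> s)) (supp \<psi>)"
    by (rule vnorm_eq) (use assms in \<open>auto simp: supp_def\<close>)
  then show ?thesis by (simp add: norm_mult L2_set_right_distrib vnorm_def)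
qed

lemma vnorm_add:
  assumes "finite (supp \<psi>)" "finite (supp \<phi>)"
  shows "vnorm (\<lambda>s. \<psi> s + \<phi> s) \<le> vnorm \<psi> + vnorm \<phi>"
proof -
  let ?A = "supp \<psi> \<union> supp \<phi>"
  have A: "finite ?A" using assms by simp
  have "vnorm (\<lambda>s. \<psi> s + \<phi> s) = L2_set (\<lambda>s. cmod (\<psi> s + \<phi> s)) ?A"
    by (rule vnorm_eq[OF A]) (auto simp: supp_def)
  also have "\<dots> \<le> L2_set (\<lambda>s. cmod (\<psi> s) + cmod (\<phi> s)) ?A"
    by (rule L2_set_mono) (auto intro: norm_triangle_ineq)
  also have "\<dots> \<le> L2_set (\<lambda>s. cmod (\<psi> s)) ?A + L2_set (\<lambda>s. cmod (\<phi> s)) ?A"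
    by (rule L2_set_triangle_ineq)
  finally show ?thesis by (simp add: vnorm_eq[OF A])
qed

definition spread :: "'e set \<Rightarrow> 'e set set \<Rightarrow> 'e set set" where
  "spread \<Lambda> S = (\<Union>s\<in>S. nbhd \<Lambda> s)"

lemma spread_finite: "finite \<Lambda> \<Longrightarrow> finite S \<Longrightarrow> finite (spread \<Lambda> S)"
  by (auto simp: spread_def finite_nbhd)

lemma spread_superset: "S \<subseteq> spread \<Lambda> S"
  by (auto simp: spread_def nbhd_def)

lemma spread_closed: "s \<in> spread \<Lambda> S \<Longrightarrow> nbhd \<Lambda> s \<subseteq> spread \<Lambda> S"
  by (auto simp: spread_def nbhd_def)

lemma supp_kapp:
  assumes "on_sites \<Lambda> K"
  shows "supp (kapp K \<psi>) \<subseteq> spread \<Lambda> (supp \<psi>)"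
proof
  fix s assume "s \<in> supp (kapp K \<psi>)"
  then have "(\<Sum>t\<in>supp \<psi>. K s t * \<psi> t) \<noteq> 0"
    by (simp add: supp_def kapp_def)
  then obtain t where "t \<in> supp \<psi>" "K s t * \<psi> t \<noteq> 0"
    by (meson sum.not_neutral_contains_not_neutral)
  then show "s \<in> spread \<Lambda> (supp \<psi>)"
    using col_subset[OF assms, of t] by (auto simp: spread_def)
qed

lemma finite_supp_kapp:
  "finite \<Lambda> \<Longrightarrow> on_sites \<Lambda> K \<Longrightarrow> finite (supp \<psi>) \<Longrightarrow> finite (supp (kapp K \<psi>))"
  using supp_kapp spread_finite by (metis finite_subset)

lemma kapp_bounded:
  assumes "finite \<Lambda>" "on_sites \<Lambda> K"
  shows "\<exists>c. \<forall>\<psi>. finite (supp \<psi>) \<longrightarrow> vnorm (kapp K \<psi>) \<le> c * vnorm \<psi>"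
proof -
  define C where "C = (\<Sum>a\<in>Pow \<Lambda>. \<Sum>b\<in>Pow \<Lambda>. cmod (K a b))"
  define N where "N = real (card (Pow \<Lambda>))"
  have C0: "C \<ge> 0" and N0: "N \<ge> 0" by (auto simp: C_def N_def sum_nonneg)
  have KC: "cmod (K s t) \<le> C" for s t
  proof (cases "s - \<Lambda> = t - \<Lambda>")
    case True
    have "cmod (K s t) = cmod (K (s \<inter> \<Lambda>) (t \<inter> \<Lambda>))"
      using on_sites_on[OF assms(2) True] by simp
    also have "\<dots> \<le> (\<Sum>b\<in>Pow \<Lambda>. cmod (K (s \<inter> \<Lambda>) b))"
      by (rule member_le_sum) (use assms in auto)
    also have "\<dots> \<le> C"
      unfolding C_def
      by (rule member_le_sum[where f = "\<lambda>a. \<Sum>b\<in>Pow \<Lambda>. cmod (K a b)"]) (use assms in \<open>auto intro: sum_nonneg\<close>)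
    finally show ?thesis .
  next
    case False
    then show ?thesis using C0 on_sites_off[OF assms(2)] by simp
  qed
  have "vnorm (kapp K \<psi>) \<le> (C * N) * vnorm \<psi>" if fin: "finite (supp \<psi>)" for \<psi>
  proof -
    let ?A = "spread \<Lambda> (supp \<psi>)"
    have A: "finite ?A" by (rule spread_finite[OF assms(1) fin])
    let ?S = "\<lambda>s. \<Sum>t\<in>nbhd \<Lambda> s. (cmod (\<psi> t))\<^sup>2"
    have pt: "(cmod (kapp K \<psi> s))\<^sup>2 \<le> C\<^sup>2 * N * ?S s" if s: "s \<in> ?A" for s
    proof -
      have fn: "finite (nbhd \<Lambda> s)" by (rule finite_nbhd[OF assms(1)])
      have "kapp K \<psi> s = (\<Sum>t\<in>?A. K s t * \<psi> t)"
        by (rule kapp_eq[OF A spread_superset])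
      also have "\<dots> = (\<Sum>t\<in>nbhd \<Lambda> s. K s t * \<psi> t)"
        by (rule sum.mono_neutral_right) (use A spread_closed[OF s] row_subset[OF assms(2), of s] in auto)
      finally have "cmod (kapp K \<psi> s) \<le> (\<Sum>t\<in>nbhd \<Lambda> s. cmod (K s t * \<psi> t))"
        by (simp add: norm_sum)
      also have "\<dots> \<le> (\<Sum>t\<in>nbhd \<Lambda> s. \<bar>C\<bar> * \<bar>cmod (\<psi> t)\<bar>)"
        by (rule sum_mono) (use KC C0 in \<open>auto simp: norm_mult intro: mult_right_mono\<close>)
      also have "\<dots> \<le> L2_set (\<lambda>_. C) (nbhd \<Lambda> s) * L2_set (\<lambda>t. cmod (\<psi> t)) (nbhd \<Lambda> s)"
        by (rule L2_set_mult_ineq)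
      finally have "(cmod (kapp K \<psi> s))\<^sup>2 \<le> (L2_set (\<lambda>_. C) (nbhd \<Lambda> s) * L2_set (\<lambda>t. cmod (\<psi> t)) (nbhd \<Lambda> s))\<^sup>2"
        by (rule power_mono) simp
      also have "\<dots> = C\<^sup>2 * N * ?S s"
        using card_nbhd[OF assms(1), of s]
        by (simp add: power_mult_distrib L2_set_def sum_nonneg N_def)
      finally show ?thesis .
    qed
    have "(vnorm (kapp K \<psi>))\<^sup>2 = (\<Sum>s\<in>?A. (cmod (kapp K \<psi> s))\<^sup>2)"
      using vnorm_eq[OF A supp_kapp[OF assms(2)]] by (simp add: L2_set_def sum_nonneg)
    also have "\<dots> \<le> (\<Sum>s\<in>?A. C\<^sup>2 * N * ?S s)"
      by (rule sum_mono[OF pt])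
    also have "\<dots> = C\<^sup>2 * N * (\<Sum>s\<in>?A. ?S s)"
      by (simp add: sum_distrib_left)
    also have "(\<Sum>s\<in>?A. ?S s) = (\<Sum>s\<in>?A. \<Sum>t\<in>?A. if t \<in> nbhd \<Lambda> s then (cmod (\<psi> t))\<^sup>2 else 0)"
    proof (rule sum.cong)
      fix s assume "s \<in> ?A"
      then have "nbhd \<Lambda> s = ?A \<inter> nbhd \<Lambda> s" using spread_closed by blast
      then show "?S s = (\<Sum>t\<in>?A. if t \<in> nbhd \<Lambda> s then (cmod (\<psi> t))\<^sup>2 else 0)"
        using A by (metis (no_types, lifting) sum.inter_restrict sum.cong)
    qed simp
    also have "\<dots> = (\<Sum>t\<in>?A. \<Sum>s\<in>?A. if t \<in> nbhd \<Lambda> s then (cmod (\<psi> t))\<^sup>2 else 0)"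
      by (rule sum.swap)
    also have "\<dots> = (\<Sum>t\<in>?A. \<Sum>s\<in>nbhd \<Lambda> t. (cmod (\<psi> t))\<^sup>2)"
    proof (rule sum.cong)
      fix t assume t: "t \<in> ?A"
      have "(\<Sum>s\<in>?A. if t \<in> nbhd \<Lambda> s then (cmod (\<psi> t))\<^sup>2 else 0)
          = (\<Sum>s\<in>?A. if s \<in> nbhd \<Lambda> t then (cmod (\<psi> t))\<^sup>2 else 0)"
        by (rule sum.cong) (auto simp: nbhd_def)
      also have "\<dots> = (\<Sum>s\<in>?A \<inter> nbhd \<Lambda> t. (cmod (\<psi> t))\<^sup>2)"
        by (rule sum.inter_restrict[OF A, symmetric])
      also have "?A \<inter> nbhd \<Lambda> t = nbhd \<Lambda> t" using spread_closed[OF t] by blast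
      finally show "(\<Sum>s\<in>?A. if t \<in> nbhd \<Lambda> s then (cmod (\<psi> t))\<^sup>2 else 0) = (\<Sum>s\<in>nbhd \<Lambda> t. (cmod (\<psi> t))\<^sup>2)" .
    qed simp
    also have "\<dots> = N * (vnorm \<psi>)\<^sup>2"
      using vnorm_eq[OF A spread_superset] card_nbhd[OF assms(1)]
      by (simp add: L2_set_def sum_nonneg N_def sum_distrib_left)
    finally have "(vnorm (kapp K \<psi>))\<^sup>2 \<le> (C * N * vnorm \<psi>)\<^sup>2"
      by (simp add: power_mult_distrib power2_eq_square mult_ac)
    then show ?thesis
      by (rule power2_le_imp_le) (intro mult_nonneg_nonneg C0 N0 vnorm_nonneg)
  qed
  then show ?thesis by blast
qed

definition basis_vec :: "'c \<Rightarrow> 'c \<Rightarrow> complex" where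
  "basis_vec t = (\<lambda>s. if s = t then 1 else 0)"

lemma supp_basis_vec: "supp (basis_vec t) = {t}"
  by (auto simp: supp_def basis_vec_def)

lemma vnorm_basis_vec: "vnorm (basis_vec t) = 1"
  by (simp add: vnorm_def supp_basis_vec) (simp add: basis_vec_def)

lemma kapp_basis_vec: "kapp K (basis_vec t) s = K s t"
  by (simp add: kapp_def supp_basis_vec) (simp add: basis_vec_def)

lemma kapp_scale: "finite (supp \<psi>) \<Longrightarrow> kapp K (\<lambda>s. c * \<psi> s) = (\<lambda>s. c * kapp K \<psi> s)"
proof
  fix s assume f: "finite (supp \<psi>)"
  have "kapp K (\<lambda>s. c * \<psi> s) s = (\<Sum>t\<in>supp \<psi>. K s t * (c * \<psi> t))"
    by (rule kapp_eq[OF f]) (auto simp: supp_def)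
  then show "kapp K (\<lambda>s. c * \<psi> s) s = c * kapp K \<psi> s"
    by (simp add: kapp_def sum_distrib_left mult_ac)
qed

lemma knorm_bdd:
  assumes "finite \<Lambda>" "on_sites \<Lambda> K"
  shows "bdd_above ((\<lambda>\<psi>. vnorm (kapp K \<psi>)) ` {\<psi>. finite (supp \<psi>) \<and> vnorm \<psi> = 1})"
proof -
  obtain c where "\<forall>\<psi>. finite (supp \<psi>) \<longrightarrow> vnorm (kapp K \<psi>) \<le> c * vnorm \<psi>"
    using kapp_bounded[OF assms] by blast
  then show ?thesis by (intro bdd_aboveI[where M = c]) force
qed

lemma knorm_bound:
  assumes "finite \<Lambda>" "on_sites \<Lambda> K" "finite (supp \<psi>)"
  shows "vnorm (kapp K \<psi>) \<le> knorm K * vnorm \<psi>"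
proof (cases "vnorm \<psi> = 0")
  case True
  then have "\<forall>s. \<psi> s = 0" by (simp add: vnorm_eq_0[OF assms(3)])
  then have "kapp K \<psi> = (\<lambda>s. 0)" by (auto simp: kapp_def)
  with True show ?thesis by (simp add: vnorm_def supp_def)
next
  case False
  let ?n = "vnorm \<psi>"
  have n: "?n > 0" using False vnorm_nonneg[of \<psi>] by simp
  let ?\<phi> = "\<lambda>s. complex_of_real (1 / ?n) * \<psi> s"
  have f: "finite (supp ?\<phi>)" by (rule finite_subset[OF _ assms(3)]) (auto simp: supp_def)
  have "vnorm ?\<phi> = 1"
    using vnorm_scale[OF assms(3), of "complex_of_real (1 / ?n)"] n by (simp add: norm_divide)
  with f have "vnorm (kapp K ?\<phi>) \<le> knorm K"
    unfolding knorm_def by (intro cSUP_upper knorm_bdd[OF assms(1,2)]) auto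
  moreover have "vnorm (kapp K ?\<phi>) = (1 / ?n) * vnorm (kapp K \<psi>)"
    using kapp_scale[OF assms(3), of K "complex_of_real (1 / ?n)"]
      vnorm_scale[OF finite_supp_kapp[OF assms], of "complex_of_real (1 / ?n)"] n by (simp add: norm_divide)
  ultimately have "(1 / ?n) * vnorm (kapp K \<psi>) \<le> knorm K" by (simp only:)
  then show ?thesis using n by (simp add: field_simps)
qed

lemma knorm_least:
  assumes "\<And>\<psi>. finite (supp \<psi>) \<Longrightarrow> vnorm \<psi> = 1 \<Longrightarrow> vnorm (kapp K \<psi>) \<le> c"
  shows "knorm K \<le> c"
  unfolding knorm_def
proof (rule cSUP_least)
  show "{\<psi> :: 'a \<Rightarrow> complex. finite (supp \<psi>) \<and> vnorm \<psi> = 1} \<noteq> {}"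
    using supp_basis_vec[of undefined] vnorm_basis_vec[of undefined]
    by (metis (mono_tags, lifting) empty_iff finite.emptyI finite_insert mem_Collect_eq)
qed (use assms in auto)

lemma knorm_nonneg:
  assumes "finite \<Lambda>" "on_sites \<Lambda> K"
  shows "0 \<le> knorm K"
  using knorm_bound[OF assms, of "basis_vec {}"] vnorm_nonneg[of "kapp K (basis_vec {})"]
  by (simp add: supp_basis_vec vnorm_basis_vec)

lemma kapp_kmult:
  assumes "finite \<Lambda>" "on_sites \<Lambda> K" "on_sites \<Lambda> L" "finite (supp \<psi>)"
  shows "kapp (kmult K L) \<psi> = kapp K (kapp L \<psi>)"
proof
  fix s
  let ?A = "spread \<Lambda> (supp \<psi>) \<union> nbhd \<Lambda> s"
  have A: "finite ?A" using spread_finite finite_nbhd assms by auto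
  have row: "{u. K s u \<noteq> 0} \<subseteq> ?A" using row_subset[OF assms(2), of s] by blast
  have "kapp (kmult K L) \<psi> s = (\<Sum>t\<in>?A. kmult K L s t * \<psi> t)"
    by (rule kapp_eq[OF A]) (use spread_superset in blast)
  also have "\<dots> = (\<Sum>t\<in>?A. \<Sum>u\<in>?A. K s u * L u t * \<psi> t)"
    by (simp only: kmult_eq_sum[where K = K and s = s, OF A row] sum_distrib_right)
  also have "\<dots> = (\<Sum>u\<in>?A. \<Sum>t\<in>?A. K s u * L u t * \<psi> t)"
    by (rule sum.swap)
  also have "\<dots> = (\<Sum>u\<in>?A. K s u * kapp L \<psi> u)"
  proof (rule sum.cong)
    fix u
    have "kapp L \<psi> u = (\<Sum>t\<in>?A. L u t * \<psi> t)"
      by (rule kapp_eq[OF A]) (use spread_superset in blast)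
    then show "(\<Sum>t\<in>?A. K s u * L u t * \<psi> t) = K s u * kapp L \<psi> u"
      by (simp only: sum_distrib_left mult.assoc)
  qed simp
  also have "\<dots> = kapp K (kapp L \<psi>) s"
    by (rule kapp_eq[OF A, symmetric]) (use supp_kapp[OF assms(3), of \<psi>] in blast)
  finally show "kapp (kmult K L) \<psi> s = kapp K (kapp L \<psi>) s" .
qed

lemma knorm_kmult:
  assumes "finite \<Lambda>" "on_sites \<Lambda> K" "on_sites \<Lambda> L"
  shows "knorm (kmult K L) \<le> knorm K * knorm L"
proof (rule knorm_least)
  fix \<psi> :: "'a set \<Rightarrow> complex" assume \<psi>: "finite (supp \<psi>)" "vnorm \<psi> = 1"
  have "vnorm (kapp (kmult K L) \<psi>) \<le> knorm K * vnorm (kapp L \<psi>)"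
    unfolding kapp_kmult[OF assms \<psi>(1)]
    by (rule knorm_bound[OF assms(1,2) finite_supp_kapp[OF assms(1,3) \<psi>(1)]])
  also have "\<dots> \<le> knorm K * (knorm L * vnorm \<psi>)"
    by (intro mult_left_mono knorm_bound[OF assms(1,3) \<psi>(1)] knorm_nonneg[OF assms(1,2)])
  finally show "vnorm (kapp (kmult K L) \<psi>) \<le> knorm K * knorm L"
    using \<psi> by simp
qed

lemma kmult_kadj: 
  assumes "finite \<Lambda>" "on_sites \<Lambda> K" "on_sites \<Lambda> L"
  shows "kadj (kmult K L) = kmult (kadj L) (kadj K)"
  unfolding kmult_eq_amplify[OF assms] 
    kmult_eq_amplify[OF assms(1) on_sites_kadj[OF assms(3)] on_sites_kadj[OF assms(2)]]
  by (intro ext) (auto simp: kadj_def amplify_def mult_ac)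

lemma inner_adj:
  assumes "finite A" "supp \<psi> \<subseteq> A" "supp \<phi> \<subseteq> A"
  shows "(\<Sum>s\<in>A. cnj (\<phi> s) * kapp K \<psi> s) = (\<Sum>t\<in>A. cnj (kapp (kadj K) \<phi> t) * \<psi> t)"
proof -
  have "(\<Sum>s\<in>A. cnj (\<phi> s) * kapp K \<psi> s) = (\<Sum>s\<in>A. \<Sum>t\<in>A. cnj (\<phi> s) * K s t * \<psi> t)"
    by (simp add: kapp_eq[OF assms(1,2)] sum_distrib_left mult_ac)
  also have "\<dots> = (\<Sum>t\<in>A. \<Sum>s\<in>A. cnj (\<phi> s) * K s t * \<psi> t)"
    by (rule sum.swap)
  also have "\<dots> = (\<Sum>t\<in>A. cnj (kapp (kadj K) \<phi> t) * \<psi> t)"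
    by (simp add: kapp_eq[OF assms(1,3)] kadj_def sum_distrib_right) (simp add: mult_ac)
  finally show ?thesis .
qed

lemma vnorm_kapp_sq:
  assumes "finite \<Lambda>" "on_sites \<Lambda> K" "finite (supp \<psi>)"
  shows "(vnorm (kapp K \<psi>))\<^sup>2 \<le> vnorm (kapp (kmult (kadj K) K) \<psi>) * vnorm \<psi>"
proof -
  let ?A = "supp \<psi> \<union> supp (kapp K \<psi>) \<union> supp (kapp (kadj K) (kapp K \<psi>))"
  note K' = on_sites_kadj[OF assms(2)]
  note f = finite_supp_kapp[OF assms]
  have A: "finite ?A"
    using assms f finite_supp_kapp[OF assms(1) K' f] by auto
  have "vnorm (kapp K \<psi>) = L2_set (\<lambda>s. cmod (kapp K \<psi> s)) ?A"
    by (rule vnorm_eq[OF A]) auto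
  then have "(vnorm (kapp K \<psi>))\<^sup>2 = (\<Sum>s\<in>?A. (cmod (kapp K \<psi> s))\<^sup>2)"
    by (simp add: L2_set_def sum_nonneg)
  then have "complex_of_real ((vnorm (kapp K \<psi>))\<^sup>2) = (\<Sum>s\<in>?A. cnj (kapp K \<psi> s) * kapp K \<psi> s)"
    by (simp only: of_real_sum complex_norm_square mult.commute)
  also have "\<dots> = (\<Sum>t\<in>?A. cnj (kapp (kadj K) (kapp K \<psi>) t) * \<psi> t)"
    by (rule inner_adj[OF A]) auto
  finally have "(vnorm (kapp K \<psi>))\<^sup>2 = cmod (\<Sum>t\<in>?A. cnj (kapp (kadj K) (kapp K \<psi>) t) * \<psi> t)"
    by (metis abs_of_nonneg norm_of_real zero_le_power2)
  also have "\<dots> \<le> (\<Sum>t\<in>?A. \<bar>cmod (kapp (kadj K) (kapp K \<psi>) t)\<bar> * \<bar>cmod (\<psi> t)\<bar>)"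
    by (rule order_trans[OF norm_sum]) (simp add: norm_mult)
  also have "\<dots> \<le> L2_set (\<lambda>t. cmod (kapp (kadj K) (kapp K \<psi>) t)) ?A * L2_set (\<lambda>t. cmod (\<psi> t)) ?A"
    by (rule L2_set_mult_ineq)
  also have "\<dots> = vnorm (kapp (kadj K) (kapp K \<psi>)) * vnorm \<psi>"
    by (intro arg_cong2[where f = "(*)"] vnorm_eq[OF A, symmetric]) auto
  finally show ?thesis by (simp add: kapp_kmult[OF assms(1) K' assms(2,3)])
qed

lemma kadj_kadj: "kadj (kadj K) = K"
  by (intro ext) (simp add: kadj_def)

lemma knorm_sq_le:
  assumes "finite \<Lambda>" "on_sites \<Lambda> K"
  shows "(knorm K)\<^sup>2 \<le> knorm (kmult (kadj K) K)"
proof -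
  note K' = on_sites_kmult[OF assms(1) on_sites_kadj[OF assms(2)] assms(2)]
  have "knorm K \<le> sqrt (knorm (kmult (kadj K) K))"
  proof (rule knorm_least)
    fix \<psi> :: "'a set \<Rightarrow> complex" assume \<psi>: "finite (supp \<psi>)" "vnorm \<psi> = 1"
    have "(vnorm (kapp K \<psi>))\<^sup>2 \<le> knorm (kmult (kadj K) K)"
      using vnorm_kapp_sq[OF assms \<psi>(1)] knorm_bound[OF assms(1) K' \<psi>(1)] \<psi>(2) by simp
    then show "vnorm (kapp K \<psi>) \<le> sqrt (knorm (kmult (kadj K) K))"
      by (rule real_le_rsqrt)
  qed
  then show ?thesis
    using knorm_nonneg[OF assms] knorm_nonneg[OF assms(1) K'] real_sqrt_ge_0_iff
    by (metis power_mono real_sqrt_pow2)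
qed

lemma knorm_kadj_le:
  assumes "finite \<Lambda>" "on_sites \<Lambda> K"
  shows "knorm K \<le> knorm (kadj K)"
proof (cases "knorm K = 0")
  case True
  then show ?thesis using knorm_nonneg[OF assms(1) on_sites_kadj[OF assms(2)]] by simp
next
  case False
  have "knorm K * knorm K \<le> knorm (kadj K) * knorm K"
    using knorm_sq_le[OF assms] knorm_kmult[OF assms(1) on_sites_kadj[OF assms(2)] assms(2)]
    by (simp add: power2_eq_square)
  with False knorm_nonneg[OF assms] show ?thesis
    by (metis mult_right_le_imp_le order_le_less)
qed

lemma knorm_kadj_kmult:
  assumes "finite \<Lambda>" "on_sites \<Lambda> K"
  shows "knorm (kmult (kadj K) K) = (knorm K)\<^sup>2"
proof (rule antisym)
  have "knorm (kadj K) = knorm K"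
    using knorm_kadj_le[OF assms] knorm_kadj_le[OF assms(1) on_sites_kadj[OF assms(2)]]
    by (simp add: kadj_kadj)
  then show "knorm (kmult (kadj K) K) \<le> (knorm K)\<^sup>2"
    using knorm_kmult[OF assms(1) on_sites_kadj[OF assms(2)] assms(2)] by (simp add: power2_eq_square)
qed (rule knorm_sq_le[OF assms])

lemma knorm_eq_0:
  assumes "finite \<Lambda>" "on_sites \<Lambda> K"
  shows "knorm K = 0 \<longleftrightarrow> K = (\<lambda>s t. 0)"
proof
  assume 0: "knorm K = 0"
  show "K = (\<lambda>s t. 0)"
  proof (intro ext)
    fix s t :: "'a set"
    have f: "finite (supp (basis_vec t))" by (simp add: supp_basis_vec)
    have "vnorm (kapp K (basis_vec t)) = 0"
      using knorm_bound[OF assms f] 0 vnorm_nonneg[of "kapp K (basis_vec t)"] by simp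
    then show "K s t = 0"
      by (simp add: vnorm_eq_0[OF finite_supp_kapp[OF assms f]] kapp_basis_vec)
  qed
next
  assume "K = (\<lambda>s t. 0)"
  then have "knorm K \<le> 0"
    by (intro knorm_least) (simp add: kapp_def vnorm_def supp_def)
  then show "knorm K = 0" using knorm_nonneg[OF assms] by simp
qed

lemma knorm_add:
  assumes "finite \<Lambda>" "on_sites \<Lambda> K" "on_sites \<Lambda> L"
  shows "knorm (\<lambda>s t. K s t + L s t) \<le> knorm K + knorm L"
proof (rule knorm_least)
  fix \<psi> :: "'a set \<Rightarrow> complex" assume \<psi>: "finite (supp \<psi>)" "vnorm \<psi> = 1"
  have "kapp (\<lambda>s t. K s t + L s t) \<psi> = (\<lambda>s. kapp K \<psi> s + kapp L \<psi> s)"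
    by (simp add: kapp_def fun_eq_iff distrib_right sum.distrib)
  then have "vnorm (kapp (\<lambda>s t. K s t + L s t) \<psi>) \<le> vnorm (kapp K \<psi>) + vnorm (kapp L \<psi>)"
    using vnorm_add finite_supp_kapp assms \<psi>(1) by metis
  also have "\<dots> \<le> knorm K * vnorm \<psi> + knorm L * vnorm \<psi>"
    by (intro add_mono knorm_bound[OF assms(1)] assms \<psi>)
  finally show "vnorm (kapp (\<lambda>s t. K s t + L s t) \<psi>) \<le> knorm K + knorm L"
    using \<psi> by simp
qed

lemma knorm_scale_le:
  assumes "finite \<Lambda>" "on_sites \<Lambda> K"
  shows "knorm (\<lambda>s t. c * K s t) \<le> cmod c * knorm K"
proof (rule knorm_least)
  fix \<psi> :: "'a set \<Rightarrow> complex" assume \<psi>: "finite (supp \<psi>)" "vnorm \<psi> = 1"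
  have "kapp (\<lambda>s t. c * K s t) \<psi> = (\<lambda>s. c * kapp K \<psi> s)"
    by (simp add: kapp_def fun_eq_iff sum_distrib_left mult_ac)
  then have "vnorm (kapp (\<lambda>s t. c * K s t) \<psi>) = cmod c * vnorm (kapp K \<psi>)"
    using vnorm_scale finite_supp_kapp assms \<psi>(1) by metis
  also have "\<dots> \<le> cmod c * (knorm K * vnorm \<psi>)"
    by (intro mult_left_mono knorm_bound[OF assms \<psi>(1)]) simp
  finally show "vnorm (kapp (\<lambda>s t. c * K s t) \<psi>) \<le> cmod c * knorm K"
    using \<psi> by simp
qed

lemma knorm_scale:
  assumes "finite \<Lambda>" "on_sites \<Lambda> K"
  shows "knorm (\<lambda>s t. c * K s t) = cmod c * knorm K"
proof (cases "c = 0")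
  case True
  have "knorm (\<lambda>s t :: 'a set. 0) = 0"
    using knorm_eq_0[OF finite.emptyI on_sites_zero] by simp
  with True show ?thesis by simp
next
  case False
  have "knorm (\<lambda>s t. inverse c * (c * K s t)) \<le> cmod (inverse c) * knorm (\<lambda>s t. c * K s t)"
    by (rule knorm_scale_le[OF assms(1) on_sites_scale[OF assms(2)]])
  with False have "cmod c * knorm K \<le> knorm (\<lambda>s t. c * K s t)"
    by (simp add: mult.assoc[symmetric] norm_inverse) (simp add: divide_simps mult.commute)
  then show ?thesis using knorm_scale_le[OF assms] by (intro antisym)
qed

lemma knorm_kone: "knorm (kone :: 'e set \<Rightarrow> 'e set \<Rightarrow> complex) = 1"
proof (rule antisym)
  have id: "kapp kone \<psi> = \<psi>" if "finite (supp \<psi>)" for \<psi> :: "'e set \<Rightarrow> complex"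
  proof
    fix s
    have "kapp kone \<psi> s = (\<Sum>t\<in>insert s (supp \<psi>). kone s t * \<psi> t)"
      by (rule kapp_eq) (use that in auto)
    also have "\<dots> = (\<Sum>t\<in>insert s (supp \<psi>). if t = s then \<psi> t else 0)"
      by (rule sum.cong) (auto simp: kone_def)
    finally show "kapp kone \<psi> s = \<psi> s" using that by simp
  qed
  show "knorm (kone :: 'e set \<Rightarrow> 'e set \<Rightarrow> complex) \<le> 1"
    by (rule knorm_least) (simp add: id)
  show "1 \<le> knorm (kone :: 'e set \<Rightarrow> 'e set \<Rightarrow> complex)"
    using knorm_bound[OF finite.emptyI on_sites_kone, of "basis_vec ({} :: 'e set)"]
    by (simp add: id supp_basis_vec vnorm_basis_vec)
qed

instantiation local_op :: (type) pre_cstar_algebra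
begin

lift_definition zero_local_op :: "'a local_op" is "\<lambda>s t. 0"
  using on_sites_zero finite.emptyI by (intro exI conjI)

lift_definition one_local_op :: "'a local_op" is kone
  using on_sites_kone finite.emptyI by (intro exI conjI)

lift_definition plus_local_op :: "'a local_op \<Rightarrow> 'a local_op \<Rightarrow> 'a local_op" is "\<lambda>K L s t. K s t + L s t"
  by (erule (1) on_sites_ex2) (rule on_sites_add)

lift_definition scaleC_local_op :: "complex \<Rightarrow> 'a local_op \<Rightarrow> 'a local_op" is "\<lambda>c K s t. c * K s t"
  by (erule exE, elim conjE) (intro exI conjI on_sites_scale)

lift_definition times_local_op :: "'a local_op \<Rightarrow> 'a local_op \<Rightarrow> 'a local_op" is kmult
  by (erule (1) on_sites_ex2) (rule on_sites_kmult)

lift_definition adj_local_op :: "'a local_op \<Rightarrow> 'a local_op" is kadj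
  by (erule exE, elim conjE) (intro exI conjI on_sites_kadj)

lift_definition norm_local_op :: "'a local_op \<Rightarrow> real" is knorm .

definition uminus_local_op :: "'a local_op \<Rightarrow> 'a local_op" where
  "uminus_local_op x = (- 1) *\<^sub>C x"

definition minus_local_op :: "'a local_op \<Rightarrow> 'a local_op \<Rightarrow> 'a local_op" where
  "minus_local_op x y = x + - y"

definition scaleR_local_op :: "real \<Rightarrow> 'a local_op \<Rightarrow> 'a local_op" where
  "scaleR_local_op r x = complex_of_real r *\<^sub>C x"

definition sgn_local_op :: "'a local_op \<Rightarrow> 'a local_op" where
  "sgn_local_op x = inverse (norm x) *\<^sub>R x"

definition dist_local_op :: "'a local_op \<Rightarrow> 'a local_op \<Rightarrow> real" where
  "dist_local_op x y = norm (x - y)"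

definition uniformity_local_op :: "('a local_op \<times> 'a local_op) filter" where
  "uniformity_local_op = (INF e\<in>{0 <..}. principal {(x, y). dist x y < e})"

definition open_local_op :: "'a local_op set \<Rightarrow> bool" where
  "open_local_op U \<longleftrightarrow> (\<forall>x\<in>U. eventually (\<lambda>(x', y). x' = x \<longrightarrow> y \<in> U) uniformity)"

lemma local_op_kernel: "\<exists>\<Lambda>. finite \<Lambda> \<and> on_sites \<Lambda> (kernel x)"
  using kernel[of x] by simp

instance
proof
  fix x y z :: "'a local_op" and c d :: complex and r q :: real and U :: "'a local_op set"
  obtain \<Lambda>1 where 1: "finite \<Lambda>1" "on_sites \<Lambda>1 (kernel x)" "on_sites \<Lambda>1 (kernel y)"
    using on_sites_common[OF local_op_kernel local_op_kernel] by blast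
  obtain \<Lambda>2 where 2: "finite \<Lambda>2" "on_sites \<Lambda>2 (kernel z)" using local_op_kernel by blast
  define \<Lambda> where "\<Lambda> = \<Lambda>1 \<union> \<Lambda>2"
  have \<Lambda>: "finite \<Lambda>" and X: "on_sites \<Lambda> (kernel x)" and Y: "on_sites \<Lambda> (kernel y)"
    and Z: "on_sites \<Lambda> (kernel z)"
    using 1(1) 2(1) on_sites_mono[OF 1(2), of \<Lambda>] on_sites_mono[OF 1(3), of \<Lambda>] on_sites_mono[OF 2(2), of \<Lambda>]
    by (simp_all add: \<Lambda>_def)
  note sg = scaleC_local_op.rep_eq plus_local_op.rep_eq zero_local_op.rep_eq one_local_op.rep_eq
    times_local_op.rep_eq adj_local_op.rep_eq norm_local_op.rep_eq scaleR_local_op_def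
    uminus_local_op_def minus_local_op_def
  note m = kmult_eq_amplify[OF \<Lambda>] on_sites_kmult[OF \<Lambda>] on_sites_add on_sites_scale X Y Z
  show "x + y + z = x + (y + z)" "x + y = y + x" "0 + x = x" "- x + x = 0" "x - y = x + - y"
    by (simp_all add: kernel_inject[symmetric] sg fun_eq_iff add_ac)
  show "r *\<^sub>R (x + y) = r *\<^sub>R x + r *\<^sub>R y" "(r + q) *\<^sub>R x = r *\<^sub>R x + q *\<^sub>R x"
    "r *\<^sub>R q *\<^sub>R x = (r * q) *\<^sub>R x" "1 *\<^sub>R x = x" "r *\<^sub>R x = complex_of_real r *\<^sub>C x"
    "c *\<^sub>C (x + y) = c *\<^sub>C x + c *\<^sub>C y" "(c + d) *\<^sub>C x = c *\<^sub>C x + d *\<^sub>C x"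
    "c *\<^sub>C d *\<^sub>C x = (c * d) *\<^sub>C x"
    by (simp_all add: kernel_inject[symmetric] sg fun_eq_iff algebra_simps)
  show "x * y * z = x * (y * z)"
    by (simp add: kernel_inject[symmetric] sg kmult_assoc[OF \<Lambda> X Y Z])
  have row: "{u. kernel w s u \<noteq> 0} \<subseteq> nbhd \<Lambda> s" if "on_sites \<Lambda> (kernel w)" for w :: "'a local_op" and s
    by (rule row_subset[OF that])
  show "1 * x = x"
  proof -
    have "kmult kone (kernel x) s t = kernel x s t" for s t
    proof -
      have "{u. kone s u \<noteq> (0 :: complex)} = {s}" by (auto simp: kone_def)
      then show ?thesis by (simp add: kmult_def) (simp add: kone_def)
    qed
    then show ?thesis by (simp add: kernel_inject[symmetric] sg fun_eq_iff)
  qed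
  show "x * 1 = x"
  proof -
    have "kmult (kernel x) kone s t = kernel x s t" for s t
    proof -
      have "finite (insert t (nbhd \<Lambda> s))" using finite_nbhd[OF \<Lambda>] by blast
      moreover from this have "kmult (kernel x) kone s t = (\<Sum>u\<in>insert t (nbhd \<Lambda> s). kernel x s u * kone u t)"
        by (rule kmult_eq_sum) (use row[OF X] in auto)
      moreover have "\<dots> = (\<Sum>u\<in>insert t (nbhd \<Lambda> s). if u = t then kernel x s u else 0)"
        by (rule sum.cong) (auto simp: kone_def)
      ultimately show ?thesis by simp
    qed
    then show ?thesis by (simp add: kernel_inject[symmetric] sg fun_eq_iff)
  qed
  show "(x + y) * z = x * z + y * z" "x * (y + z) = x * y + x * z"
    "(c *\<^sub>C x) * y = c *\<^sub>C (x * y)" "x * (c *\<^sub>C y) = c *\<^sub>C (x * y)"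
    "(r *\<^sub>R x) * y = r *\<^sub>R (x * y)" "x * (r *\<^sub>R y) = r *\<^sub>R (x * y)"
    by (simp_all add: kernel_inject[symmetric] sg m fun_eq_iff)
       (simp_all add: amplify_def algebra_simps sum.distrib sum_distrib_left)
  show "(0 :: 'a local_op) \<noteq> 1"
    by (auto simp: kernel_inject[symmetric] sg fun_eq_iff kone_def)
  show "norm (1 :: 'a local_op) = 1" by (simp add: sg knorm_kone)
  show "norm x = 0 \<longleftrightarrow> x = 0"
    by (simp add: sg kernel_inject[symmetric] knorm_eq_0[OF \<Lambda> X])
  show "norm (x + y) \<le> norm x + norm y"
    by (simp add: sg knorm_add[OF \<Lambda> X Y])
  show "norm (x * y) \<le> norm x * norm y"
    by (simp add: sg knorm_kmult[OF \<Lambda> X Y])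
  show "norm (c *\<^sub>C x) = cmod c * norm x" "norm (r *\<^sub>R x) = \<bar>r\<bar> * norm x"
    by (simp_all add: sg knorm_scale[OF \<Lambda> X])
  show "adj (adj x) = x" "adj (x + y) = adj x + adj y" "adj (c *\<^sub>C x) = cnj c *\<^sub>C adj x"
    by (simp_all add: kernel_inject[symmetric] sg kadj_def fun_eq_iff)
  show "adj (x * y) = adj y * adj x"
    by (simp add: kernel_inject[symmetric] sg kmult_kadj[OF \<Lambda> X Y])
  show "norm (adj x * x) = (norm x)\<^sup>2"
    by (simp add: sg knorm_kadj_kmult[OF \<Lambda> X])
  show "sgn x = inverse (norm x) *\<^sub>R x" by (rule sgn_local_op_def)
  show "dist x y = norm (x - y)" by (rule dist_local_op_def)
  show "(uniformity :: ('a local_op \<times> 'a local_op) filter) = (INF e\<in>{0 <..}. principal {(x, y). dist x y < e})"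
    by (rule uniformity_local_op_def)
  show "open U \<longleftrightarrow> (\<forall>x\<in>U. eventually (\<lambda>(x', y). x' = x \<longrightarrow> y \<in> U) uniformity)"
    by (rule open_local_op_def)
qed

end


section \<open>Completion\<close>

text \<open>Cauchy sequences modulo null sequences, with pointwise operations.\<close>

definition cauchy_equiv :: "(nat \<Rightarrow> 'a :: pre_cstar_algebra) \<Rightarrow> (nat \<Rightarrow> 'a) \<Rightarrow> bool" where
  "cauchy_equiv X Y \<longleftrightarrow> Cauchy X \<and> Cauchy Y \<and> (\<lambda>n. X n - Y n) \<longlonglongrightarrow> 0"

lemma cauchy_equiv_refl [simp]: "cauchy_equiv X X \<longleftrightarrow> Cauchy X"
  by (simp add: cauchy_equiv_def)

lemma cauchy_equiv_sym: "cauchy_equiv X Y \<Longrightarrow> cauchy_equiv Y X"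
  using tendsto_minus[of "\<lambda>n. X n - Y n" 0 sequentially] by (simp add: cauchy_equiv_def)

lemma cauchy_equiv_trans: "cauchy_equiv X Y \<Longrightarrow> cauchy_equiv Y Z \<Longrightarrow> cauchy_equiv X Z"
  using tendsto_add[of "\<lambda>n. X n - Y n" 0 sequentially "\<lambda>n. Y n - Z n" 0]
  by (simp add: cauchy_equiv_def)

quotient_type (overloaded) 'a cstar_completion = "nat \<Rightarrow> 'a :: pre_cstar_algebra" / partial: cauchy_equiv
proof (rule part_equivpI)
  have "cauchy_equiv (\<lambda>_. 0 :: 'a) (\<lambda>_. 0)" by (simp add: Cauchy_def)
  then show "\<exists>X :: nat \<Rightarrow> 'a. cauchy_equiv X X" by blast
  show "symp (cauchy_equiv :: (nat \<Rightarrow> 'a) \<Rightarrow> _)" by (blast intro: sympI cauchy_equiv_sym)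
  show "transp (cauchy_equiv :: (nat \<Rightarrow> 'a) \<Rightarrow> _)" by (blast intro: transpI cauchy_equiv_trans)
qed

lemma cauchy_seq_add:
  fixes X Y :: "nat \<Rightarrow> 'a :: real_normed_vector"
  assumes "Cauchy X" "Cauchy Y"
  shows "Cauchy (\<lambda>n. X n + Y n)"
proof (rule CauchyI)
  fix e :: real assume "0 < e"
  then have "0 < e / 2" by simp
  from CauchyD[OF assms(1) this] CauchyD[OF assms(2) this]
  obtain M N where M: "\<forall>m\<ge>M. \<forall>n\<ge>M. norm (X m - X n) < e / 2"
    and N: "\<forall>m\<ge>N. \<forall>n\<ge>N. norm (Y m - Y n) < e / 2" by blast
  have "norm ((X m + Y m) - (X n + Y n)) < e" if "m \<ge> max M N" "n \<ge> max M N" for m n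
  proof -
    have "norm ((X m + Y m) - (X n + Y n)) \<le> norm (X m - X n) + norm (Y m - Y n)"
      by (rule norm_diff_triangle_ineq)
    also have "\<dots> < e / 2 + e / 2"
      by (rule add_strict_mono) (use M N that in auto)
    finally show ?thesis by simp
  qed
  then show "\<exists>M. \<forall>m\<ge>M. \<forall>n\<ge>M. norm ((X m + Y m) - (X n + Y n)) < e" by blast
qed

lemma cauchy_seq_mult:
  fixes X Y :: "nat \<Rightarrow> 'a :: real_normed_algebra"
  assumes "Cauchy X" "Cauchy Y"
  shows "Cauchy (\<lambda>n. X n * Y n)"
proof (rule CauchyI)
  fix e :: real assume e: "0 < e"
  obtain A where A: "A > 0" "\<And>n. norm (X n) \<le> A"
    using Cauchy_Bseq[OF assms(1)] by (auto simp: Bseq_def)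
  obtain B where B: "B > 0" "\<And>n. norm (Y n) \<le> B"
    using Cauchy_Bseq[OF assms(2)] by (auto simp: Bseq_def)
  have e': "0 < e / (2 * B)" "0 < e / (2 * A)" using e A B by auto
  obtain M N where M: "\<forall>m\<ge>M. \<forall>n\<ge>M. norm (X m - X n) < e / (2 * B)"
    and N: "\<forall>m\<ge>N. \<forall>n\<ge>N. norm (Y m - Y n) < e / (2 * A)"
    using CauchyD[OF assms(1) e'(1)] CauchyD[OF assms(2) e'(2)] by blast
  have "norm (X m * Y m - X n * Y n) < e" if "m \<ge> max M N" "n \<ge> max M N" for m n
  proof -
    have "X m * Y m - X n * Y n = (X m - X n) * Y m + X n * (Y m - Y n)"
      by (simp add: algebra_simps)
    then have "norm (X m * Y m - X n * Y n) \<le> norm ((X m - X n) * Y m) + norm (X n * (Y m - Y n))"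
      by (simp add: norm_triangle_ineq)
    also have "\<dots> \<le> norm (X m - X n) * norm (Y m) + norm (X n) * norm (Y m - Y n)"
      by (intro add_mono norm_mult_ineq)
    also have "\<dots> \<le> norm (X m - X n) * B + A * norm (Y m - Y n)"
      by (intro add_mono mult_left_mono mult_right_mono A B norm_ge_zero)
    also have "\<dots> < (e / (2 * B)) * B + A * (e / (2 * A))"
      by (intro add_strict_mono mult_strict_right_mono mult_strict_left_mono) (use M N A B that in auto)
    also have "\<dots> = e" using A B by simp
    finally show ?thesis .
  qed
  then show "\<exists>M. \<forall>m\<ge>M. \<forall>n\<ge>M. norm (X m * Y m - X n * Y n) < e" by blast
qed

lemma bounded_linear_scaleC: "bounded_linear (\<lambda>x :: 'a :: pre_cstar_algebra. c *\<^sub>C x)"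
  by (rule bounded_linear_intro[where K = "cmod c"])
     (simp_all add: scaleC_add_right scaleR_scaleC scaleC_scaleC norm_scaleC mult.commute)

lemma bounded_linear_adj: "bounded_linear (adj :: 'a :: pre_cstar_algebra \<Rightarrow> 'a)"
  by (rule bounded_linear_intro[where K = 1]) (simp_all add: adj_add scaleR_scaleC adj_scaleC norm_adj)

lemma cauchy_equiv_linear:
  assumes "bounded_linear f" "cauchy_equiv X Y"
  shows "cauchy_equiv (\<lambda>n. f (X n)) (\<lambda>n. f (Y n))"
  using assms bounded_linear.Cauchy[OF assms(1)]
    bounded_linear.tendsto_zero[OF assms(1), of "\<lambda>n. X n - Y n"]
  by (simp add: cauchy_equiv_def linear_diff[OF bounded_linear.linear[OF assms(1)]])

lemma cauchy_equiv_add: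
  assumes "cauchy_equiv X X'" "cauchy_equiv Y Y'"
  shows "cauchy_equiv (\<lambda>n. X n + Y n) (\<lambda>n. X' n + Y' n)"
  using assms tendsto_add[of "\<lambda>n. X n - X' n" 0 sequentially "\<lambda>n. Y n - Y' n" 0]
  by (simp add: cauchy_equiv_def add_diff_add cauchy_seq_add)

lemma cauchy_equiv_mult:
  assumes "cauchy_equiv X X'" "cauchy_equiv Y Y'"
  shows "cauchy_equiv (\<lambda>n. X n * Y n) (\<lambda>n. X' n * Y' n)"
proof -
  have B: "Bfun Y sequentially" "Bfun X' sequentially"
    using assms Cauchy_Bseq by (auto simp: cauchy_equiv_def)
  have Z: "Zfun (\<lambda>n. X n - X' n) sequentially" "Zfun (\<lambda>n. Y n - Y' n) sequentially"
    using assms by (auto simp: cauchy_equiv_def tendsto_Zfun_iff)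
  have "Zfun (\<lambda>n. (X n - X' n) * Y n + X' n * (Y n - Y' n)) sequentially"
    by (intro Zfun_add bounded_bilinear.Zfun_prod_Bfun[OF bounded_bilinear_mult Z(1) B(1)]
        bounded_bilinear.Bfun_prod_Zfun[OF bounded_bilinear_mult B(2) Z(2)])
  then have "(\<lambda>n. X n * Y n - X' n * Y' n) \<longlonglongrightarrow> 0"
    by (simp add: tendsto_Zfun_iff algebra_simps)
  then show ?thesis
    using assms by (simp add: cauchy_equiv_def cauchy_seq_mult)
qed

lemma cauchy_norm_lim:
  fixes X :: "nat \<Rightarrow> 'a :: real_normed_vector"
  assumes "Cauchy X"
  shows "(\<lambda>n. norm (X n)) \<longlonglongrightarrow> lim (\<lambda>n. norm (X n))"
proof -
  have "Cauchy (\<lambda>n. norm (X n))"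
  proof (rule CauchyI)
    fix e :: real assume "0 < e"
    from CauchyD[OF assms this] obtain M where "\<forall>m\<ge>M. \<forall>n\<ge>M. norm (X m - X n) < e" ..
    then show "\<exists>M. \<forall>m\<ge>M. \<forall>n\<ge>M. norm (norm (X m) - norm (X n)) < e"
      by (metis norm_triangle_ineq3 order_le_less_trans real_norm_def)
  qed
  then show ?thesis by (simp add: Cauchy_convergent_iff convergent_LIMSEQ_iff)
qed

lemma cauchy_equiv_norm_lim:
  assumes "cauchy_equiv X Y"
  shows "lim (\<lambda>n. norm (X n)) = lim (\<lambda>n. norm (Y n))"
proof -
  have X: "Cauchy X" and Y: "Cauchy Y" and d: "(\<lambda>n. X n - Y n) \<longlonglongrightarrow> 0"
    using assms by (auto simp: cauchy_equiv_def)
  have "(\<lambda>n. norm (X n) - norm (Y n)) \<longlonglongrightarrow> 0"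
    by (rule Lim_null_comparison[OF _ tendsto_norm_zero[OF d]]) (simp add: norm_triangle_ineq3)
  moreover have "(\<lambda>n. norm (X n) - norm (Y n)) \<longlonglongrightarrow> lim (\<lambda>n. norm (X n)) - lim (\<lambda>n. norm (Y n))"
    by (intro tendsto_diff cauchy_norm_lim X Y)
  ultimately show ?thesis using LIMSEQ_unique by fastforce
qed

instantiation cstar_completion :: (pre_cstar_algebra) pre_cstar_algebra
begin

lift_definition zero_cstar_completion :: "'a cstar_completion" is "\<lambda>_. 0"
  by (simp add: Cauchy_def)

lift_definition one_cstar_completion :: "'a cstar_completion" is "\<lambda>_. 1"
  by (simp add: Cauchy_def)

lift_definition plus_cstar_completion :: "'a cstar_completion \<Rightarrow> 'a cstar_completion \<Rightarrow> 'a cstar_completion"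
  is "\<lambda>X Y n. X n + Y n"
  by (rule cauchy_equiv_add)

lift_definition times_cstar_completion :: "'a cstar_completion \<Rightarrow> 'a cstar_completion \<Rightarrow> 'a cstar_completion"
  is "\<lambda>X Y n. X n * Y n"
  by (rule cauchy_equiv_mult)

lift_definition scaleC_cstar_completion :: "complex \<Rightarrow> 'a cstar_completion \<Rightarrow> 'a cstar_completion"
  is "\<lambda>c X n. c *\<^sub>C X n"
  by (rule cauchy_equiv_linear[OF bounded_linear_scaleC])

lift_definition adj_cstar_completion :: "'a cstar_completion \<Rightarrow> 'a cstar_completion"
  is "\<lambda>X n. adj (X n)"
  by (rule cauchy_equiv_linear[OF bounded_linear_adj])

lift_definition norm_cstar_completion :: "'a cstar_completion \<Rightarrow> real"
  is "\<lambda>X. lim (\<lambda>n. norm (X n))"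
  by (rule cauchy_equiv_norm_lim)

definition uminus_cstar_completion :: "'a cstar_completion \<Rightarrow> 'a cstar_completion" where
  "uminus_cstar_completion x = (- 1) *\<^sub>C x"

definition minus_cstar_completion :: "'a cstar_completion \<Rightarrow> 'a cstar_completion \<Rightarrow> 'a cstar_completion" where
  "minus_cstar_completion x y = x + - y"

definition scaleR_cstar_completion :: "real \<Rightarrow> 'a cstar_completion \<Rightarrow> 'a cstar_completion" where
  "scaleR_cstar_completion r x = complex_of_real r *\<^sub>C x"

definition sgn_cstar_completion :: "'a cstar_completion \<Rightarrow> 'a cstar_completion" where
  "sgn_cstar_completion x = inverse (norm x) *\<^sub>R x"

definition dist_cstar_completion :: "'a cstar_completion \<Rightarrow> 'a cstar_completion \<Rightarrow> real" where
  "dist_cstar_completion x y = norm (x - y)"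

definition uniformity_cstar_completion :: "('a cstar_completion \<times> 'a cstar_completion) filter" where
  "uniformity_cstar_completion = (INF e\<in>{0 <..}. principal {(x, y). dist x y < e})"

definition open_cstar_completion :: "'a cstar_completion set \<Rightarrow> bool" where
  "open_cstar_completion U \<longleftrightarrow> (\<forall>x\<in>U. eventually (\<lambda>(x', y). x' = x \<longrightarrow> y \<in> U) uniformity)"

instance
proof
  fix x y z :: "'a cstar_completion" and c d :: complex and r q :: real and U :: "'a cstar_completion set"
  note C = cauchy_seq_add cauchy_seq_mult bounded_linear.Cauchy[OF bounded_linear_scaleC]
    bounded_linear.Cauchy[OF bounded_linear_adj]
  note defs = scaleR_cstar_completion_def uminus_cstar_completion_def minus_cstar_completion_def
  show "x + y + z = x + (y + z)"
    by transfer (simp add: C add.assoc)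
  show "x + y = y + x"
    by transfer (simp add: C add.commute)
  show "0 + x = x"
    by transfer simp
  show "- x + x = 0"
    unfolding defs by transfer (simp add: C scaleC_minus1 cauchy_equiv_def Cauchy_def)
  show "x - y = x + - y"
    by (simp add: defs)
  show "c *\<^sub>C (x + y) = c *\<^sub>C x + c *\<^sub>C y"
    by transfer (simp add: C flip: scaleC_add_right)
  show "(c + d) *\<^sub>C x = c *\<^sub>C x + d *\<^sub>C x"
    by transfer (simp add: C flip: scaleC_add_left)
  show "c *\<^sub>C d *\<^sub>C x = (c * d) *\<^sub>C x"
    by transfer (simp add: C scaleC_scaleC)
  show "r *\<^sub>R (x + y) = r *\<^sub>R x + r *\<^sub>R y"
    unfolding defs by transfer (simp add: C flip: scaleC_add_right)
  show "(r + q) *\<^sub>R x = r *\<^sub>R x + q *\<^sub>R x"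
    unfolding defs of_real_add by transfer (simp add: C flip: scaleC_add_left)
  show "r *\<^sub>R q *\<^sub>R x = (r * q) *\<^sub>R x"
    unfolding defs of_real_mult by transfer (simp add: C scaleC_scaleC)
  show "1 *\<^sub>R x = x"
    unfolding defs of_real_1 by transfer (simp add: scaleC_one)
  show "r *\<^sub>R x = complex_of_real r *\<^sub>C x"
    by (rule scaleR_cstar_completion_def)
  show "x * y * z = x * (y * z)"
    by transfer (simp add: C mult.assoc)
  show "1 * x = x" "x * 1 = x"
    by (transfer, simp)+
  show "(x + y) * z = x * z + y * z"
    by transfer (simp add: C flip: distrib_right)
  show "x * (y + z) = x * y + x * z"
    by transfer (simp add: C flip: distrib_left)
  show "(c *\<^sub>C x) * y = c *\<^sub>C (x * y)"
    by transfer (simp add: C mult_scaleC_left)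
  show "x * (c *\<^sub>C y) = c *\<^sub>C (x * y)"
    by transfer (simp add: C mult_scaleC_right)
  show "(r *\<^sub>R x) * y = r *\<^sub>R (x * y)"
    unfolding defs by transfer (simp add: C mult_scaleC_left)
  show "x * (r *\<^sub>R y) = r *\<^sub>R (x * y)"
    unfolding defs by transfer (simp add: C mult_scaleC_right)
  show "(0 :: 'a cstar_completion) \<noteq> 1"
    by transfer (simp add: cauchy_equiv_def LIMSEQ_const_iff)
  show "norm (1 :: 'a cstar_completion) = 1"
    by transfer simp
  show "norm x = 0 \<longleftrightarrow> x = 0"
  proof transfer
    fix X :: "nat \<Rightarrow> 'a" assume "cauchy_equiv X X"
    then have X: "Cauchy X" by simp
    have "lim (\<lambda>n. norm (X n)) = 0 \<longleftrightarrow> (\<lambda>n. norm (X n)) \<longlonglongrightarrow> 0"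
      using cauchy_norm_lim[OF X] LIMSEQ_unique by auto
    also have "\<dots> \<longleftrightarrow> cauchy_equiv X (\<lambda>_. 0)"
      using X by (simp add: cauchy_equiv_def tendsto_norm_zero_iff) (simp add: Cauchy_def)
    finally show "lim (\<lambda>n. norm (X n)) = 0 \<longleftrightarrow> cauchy_equiv X (\<lambda>_. 0)" .
  qed
  show "norm (x + y) \<le> norm x + norm y"
  proof transfer
    fix X Y :: "nat \<Rightarrow> 'a" assume "cauchy_equiv X X" "cauchy_equiv Y Y"
    then have X: "Cauchy X" and Y: "Cauchy Y" by simp_all
    show "lim (\<lambda>n. norm (X n + Y n)) \<le> lim (\<lambda>n. norm (X n)) + lim (\<lambda>n. norm (Y n))"
      by (rule LIMSEQ_le[OF cauchy_norm_lim[OF C(1)[OF X Y]] tendsto_add[OF cauchy_norm_lim[OF X] cauchy_norm_lim[OF Y]]])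
         (auto intro: norm_triangle_ineq)
  qed
  show "norm (x * y) \<le> norm x * norm y"
  proof transfer
    fix X Y :: "nat \<Rightarrow> 'a" assume "cauchy_equiv X X" "cauchy_equiv Y Y"
    then have X: "Cauchy X" and Y: "Cauchy Y" by simp_all
    show "lim (\<lambda>n. norm (X n * Y n)) \<le> lim (\<lambda>n. norm (X n)) * lim (\<lambda>n. norm (Y n))"
      by (rule LIMSEQ_le[OF cauchy_norm_lim[OF C(2)[OF X Y]] tendsto_mult[OF cauchy_norm_lim[OF X] cauchy_norm_lim[OF Y]]])
         (auto intro: norm_mult_ineq)
  qed
  show norm_scaleC: "norm (c *\<^sub>C x) = cmod c * norm x" for c :: complex
  proof transfer
    fix X :: "nat \<Rightarrow> 'a" and c :: complex assume "cauchy_equiv X X"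
    then have X: "Cauchy X" by simp
    show "lim (\<lambda>n. norm (c *\<^sub>C X n)) = cmod c * lim (\<lambda>n. norm (X n))"
      using tendsto_mult_left[OF cauchy_norm_lim[OF X], of "cmod c"] by (simp add: norm_scaleC limI)
  qed
  show "norm (r *\<^sub>R x) = \<bar>r\<bar> * norm x"
    unfolding defs by (simp add: norm_scaleC)
  show "adj (adj x) = x"
    by transfer (simp add: adj_adj)
  show "adj (x + y) = adj x + adj y"
    by transfer (simp add: C flip: adj_add)
  show "adj (c *\<^sub>C x) = cnj c *\<^sub>C adj x"
    by transfer (simp add: C adj_scaleC)
  show "adj (x * y) = adj y * adj x"
    by transfer (simp add: C adj_mult)
  show "norm (adj x * x) = (norm x)\<^sup>2"
  proof transfer
    fix X :: "nat \<Rightarrow> 'a" assume "cauchy_equiv X X"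
    then have X: "Cauchy X" by simp
    show "lim (\<lambda>n. norm (adj (X n) * X n)) = (lim (\<lambda>n. norm (X n)))\<^sup>2"
      using tendsto_power[OF cauchy_norm_lim[OF X], of 2] by (simp add: norm_adj_mult_self limI)
  qed
  show "sgn x = inverse (norm x) *\<^sub>R x" by (rule sgn_cstar_completion_def)
  show "dist x y = norm (x - y)" by (rule dist_cstar_completion_def)
  show "(uniformity :: ('a cstar_completion \<times> 'a cstar_completion) filter)
      = (INF e\<in>{0 <..}. principal {(x, y). dist x y < e})"
    by (rule uniformity_cstar_completion_def)
  show "open U \<longleftrightarrow> (\<forall>x\<in>U. eventually (\<lambda>(x', y). x' = x \<longrightarrow> y \<in> U) uniformity)"
    by (rule open_cstar_completion_def)
qed

end

lift_definition completion_of :: "'a :: pre_cstar_algebra \<Rightarrow> 'a cstar_completion" is "\<lambda>x _. x"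
  by (simp add: Cauchy_def)

lemma completion_of_add: "completion_of (x + y) = completion_of x + completion_of y"
  by transfer (simp add: Cauchy_def)

lemma completion_of_mult: "completion_of (x * y) = completion_of x * completion_of y"
  by transfer (simp add: Cauchy_def)

lemma completion_of_scaleC: "completion_of (c *\<^sub>C x) = c *\<^sub>C completion_of x"
  by transfer (simp add: Cauchy_def)

lemma completion_of_adj: "completion_of (adj x) = adj (completion_of x)"
  by transfer (simp add: Cauchy_def)

lemma completion_of_one: "completion_of 1 = 1"
  by transfer (simp add: Cauchy_def)

lemma completion_of_diff: "completion_of (x - y) = completion_of x - completion_of y"
  by (metis completion_of_add add_diff_cancel diff_add_cancel)

lemma norm_completion_of: "norm (completion_of x) = norm x"
  by transfer simp

lemma completion_of_tendsto:
  assumes X: "Cauchy X"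
  shows "(\<lambda>k. completion_of (X k)) \<longlonglongrightarrow> abs_cstar_completion X"
proof (rule LIMSEQ_I)
  fix e :: real assume "0 < e"
  then have "0 < e / 2" by simp
  from CauchyD[OF X this] obtain M where M: "\<forall>m\<ge>M. \<forall>n\<ge>M. norm (X m - X n) < e / 2" ..
  have "norm (completion_of (X k) - abs_cstar_completion X) < e" if k: "k \<ge> M" for k
  proof -
    let ?Y = "\<lambda>n. X k + (- 1) *\<^sub>C X n"
    have Y: "Cauchy ?Y"
      by (intro cauchy_seq_add bounded_linear.Cauchy[OF bounded_linear_scaleC] X) (simp add: Cauchy_def)
    have "completion_of (X k) - abs_cstar_completion X = abs_cstar_completion ?Y"
      unfolding minus_cstar_completion_def uminus_cstar_completion_def completion_of_def map_fun_def
      using X by (simp add: scaleC_cstar_completion.abs_eq plus_cstar_completion.abs_eq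
          bounded_linear.Cauchy[OF bounded_linear_scaleC] Cauchy_def[of "\<lambda>_. _"])
    then have n: "norm (completion_of (X k) - abs_cstar_completion X) = lim (\<lambda>n. norm (?Y n))"
      using Y by (simp add: norm_cstar_completion.abs_eq)
    have "lim (\<lambda>n. norm (?Y n)) \<le> e / 2"
    proof (rule LIMSEQ_le_const2[OF cauchy_norm_lim[OF Y]])
      show "\<exists>N. \<forall>n\<ge>N. norm (?Y n) \<le> e / 2"
        using M k by (intro exI[of _ M]) (auto simp: scaleC_minus1 less_imp_le)
    qed
    with n \<open>0 < e\<close> show ?thesis by simp
  qed
  then show "\<exists>M. \<forall>k\<ge>M. norm (completion_of (X k) - abs_cstar_completion X) < e" by blast
qed

lemma completion_of_dense: "0 < e \<Longrightarrow> \<exists>a. norm (completion_of a - x) < e"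
proof -
  assume e: "0 < e"
  obtain X where X: "Cauchy X" and x: "x = abs_cstar_completion X"
    by (metis Quotient3_abs_rep Quotient3_cstar_completion Quotient3_rep_reflp cauchy_equiv_refl)
  from LIMSEQ_D[OF completion_of_tendsto[OF X] e]
  show ?thesis unfolding x by blast
qed

instance cstar_completion :: (pre_cstar_algebra) cstar_algebra
proof
  fix S :: "nat \<Rightarrow> 'a cstar_completion" assume S: "Cauchy S"
  have "\<exists>a. norm (completion_of a - S k) < inverse (real (Suc k))" for k
    by (rule completion_of_dense) simp
  then obtain a where a: "\<And>k. norm (completion_of (a k) - S k) < inverse (real (Suc k))" by metis
  have "(\<lambda>k. completion_of (a k) - S k) \<longlonglongrightarrow> 0"
    by (rule Lim_null_comparison[OF _ LIMSEQ_inverse_real_of_nat]) (intro always_eventually allI less_imp_le a)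
  note d = this
  have "Cauchy (\<lambda>k. (completion_of (a k) - S k) + S k)"
    by (rule cauchy_seq_add[OF LIMSEQ_imp_Cauchy[OF d] S])
  then have "Cauchy a"
    by (simp add: Cauchy_iff norm_completion_of flip: completion_of_diff)
  from tendsto_diff[OF completion_of_tendsto[OF this] d]
  show "convergent S" by (auto simp: convergent_def)
qed


section \<open>The toric code\<close>

type_synonym vertex = "int \<times> int"

text \<open>\<open>Hor (x, y)\<close> joins \<open>(x, y)\<close> to \<open>(x + 1, y)\<close> and \<open>Vert (x, y)\<close> joins \<open>(x, y)\<close> to \<open>(x, y + 1)\<close>.\<close>

datatype edge = Hor vertex | Vert vertex

fun endpoints :: "edge \<Rightarrow> vertex set" where
  "endpoints (Hor (x, y)) = {(x, y), (x + 1, y)}"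
| "endpoints (Vert (x, y)) = {(x, y), (x, y + 1)}"

text \<open>A face is given by its lower left corner.\<close>

type_synonym face = "int \<times> int"

fun corners :: "face \<Rightarrow> vertex set" where
  "corners (x, y) = {(x, y), (x + 1, y), (x, y + 1), (x + 1, y + 1)}"

definition star_edges :: "vertex \<Rightarrow> edge set" where
  "star_edges v = {e. v \<in> endpoints e}"

definition face_edges :: "face \<Rightarrow> edge set" where
  "face_edges f = {e. endpoints e \<subseteq> corners f}"

lemma star_edges_eq:
  "star_edges (x, y) = {Hor (x, y), Hor (x - 1, y), Vert (x, y), Vert (x, y - 1)}"
  unfolding star_edges_def
proof (intro set_eqI iffI)
  fix e assume "e \<in> {e. (x, y) \<in> endpoints e}"
  then show "e \<in> {Hor (x, y), Hor (x - 1, y), Vert (x, y), Vert (x, y - 1)}"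
    by (cases e rule: endpoints.cases) auto
qed auto

lemma face_edges_eq:
  "face_edges (x, y) = {Hor (x, y), Hor (x, y + 1), Vert (x, y), Vert (x + 1, y)}"
  unfolding face_edges_def
proof (intro set_eqI iffI)
  fix e assume "e \<in> {e. endpoints e \<subseteq> corners (x, y)}"
  then show "e \<in> {Hor (x, y), Hor (x, y + 1), Vert (x, y), Vert (x + 1, y)}"
    by (cases e rule: endpoints.cases) auto
qed auto

type_synonym quasi_local = "edge local_op cstar_completion"

text \<open>For a matrix \<open>P\<close> in \<open>M\<^sub>2(\<complex>)\<close>, indexed by \<open>False\<close> (spin up) and \<open>True\<close> (spin down), its copy
  at the site \<open>e\<close>.\<close>

lift_definition site_op :: "'e \<Rightarrow> (bool \<Rightarrow> bool \<Rightarrow> complex) \<Rightarrow> 'e local_op"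
  is "\<lambda>e P. amplify {e} (\<lambda>r r'. P (e \<in> r) (e \<in> r'))"
  using on_sites_amplify finite.emptyI finite.insertI by (intro exI conjI)

definition pauli_x :: "bool \<Rightarrow> bool \<Rightarrow> complex" where
  "pauli_x a b = (if a = b then 0 else 1)"

definition pauli_z :: "bool \<Rightarrow> bool \<Rightarrow> complex" where
  "pauli_z a b = (if a = b then (if a then - 1 else 1) else 0)"

definition sigma_x :: "edge \<Rightarrow> quasi_local" where
  "sigma_x e = completion_of (site_op e pauli_x)"

definition sigma_z :: "edge \<Rightarrow> quasi_local" where
  "sigma_z e = completion_of (site_op e pauli_z)"

text \<open>The products run over \<open>star_edges v\<close> and \<open>face_edges f\<close>; the factors commute.\<close>

fun star_op :: "vertex \<Rightarrow> quasi_local" where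
  "star_op (x, y) = sigma_x (Hor (x, y)) * sigma_x (Hor (x - 1, y)) * sigma_x (Vert (x, y)) * sigma_x (Vert (x, y - 1))"

fun face_op :: "face \<Rightarrow> quasi_local" where
  "face_op (x, y) = sigma_z (Hor (x, y)) * sigma_z (Hor (x, y + 1)) * sigma_z (Vert (x, y)) * sigma_z (Vert (x + 1, y))"

fun upper_star_edge :: "vertex \<Rightarrow> edge" where
  "upper_star_edge (x, y) = Vert (x, y)"

fun upper_face_edge :: "face \<Rightarrow> edge" where
  "upper_face_edge (x, y) = Hor (x, y + 1)"

definition toric_algebra :: "quasi_local set" where
  "toric_algebra = generated_cstar (range star_op \<union> range face_op)"

definition diagonal_algebra :: "quasi_local set" where
  "diagonal_algebra = generated_cstar (range sigma_z)"

end

(* If Phi extends alpha, then u = Phi^-1(sigma^x) at the upper edge of a vertex v0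
   is a unitary of the whole algebra that anticommutes with the star operator at v0 and commutes
   with all the others: it creates a single charge.  Approximate u by a local operator a on a
   finite set L of edges, and let V be a finite set of vertices that contains v0 and the endpoints
   of L.  The product W of the star operators over V is a unitary anticommuting with u, but it is
   also the product of sigma^x over the edges with exactly one endpoint in V, hence it commutes
   with a.  So 2 = ||uW - Wu|| <= 2 ||u - a||, a contradiction. *)

theory Submission
  imports Defs
begin

section \<open>Norm estimates and automorphisms in C*-algebras\<close>

lemma norm_isometry:
  fixes x :: "'a :: pre_cstar_algebra"
  assumes "adj x * x = 1"
  shows "norm x = 1"
  using norm_adj_mult_self[of x] assms by (simp add: power2_eq_1_iff) (smt (verit) norm_ge_zero)

text \<open>The commutator of \<open>u\<close> and \<open>w\<close> is
  \<open>2 *\<^sub>R (u * w)\<close>, of norm 2 because \<open>u * w\<close> is an isometry.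
  Subtracting \<open>a\<close> from \<open>u\<close> leaves the commutator unchanged, and it is then
  bounded by \<open>2 * norm (u - a)\<close>.\<close>

lemma anticommute_norm_diff:
  fixes u w a :: "'a :: pre_cstar_algebra"
  assumes "adj u * u = 1" "adj w * w = 1" "u * w = - (w * u)" "a * w = w * a"
  shows "1 \<le> norm (u - a)"
proof -
  have "adj (u * w) * (u * w) = adj w * (adj u * u) * w"
    by (simp add: adj_mult mult.assoc)
  then have uw: "norm (u * w) = 1"
    using assms by (intro norm_isometry) simp
  have "u * w - w * u = 2 *\<^sub>R (u * w)"
    using assms(3) by (simp add: scaleR_2)
  then have "2 = norm (u * w - w * u)"
    using uw by simp
  also have "\<dots> = norm ((u - a) * w - w * (u - a))"
    by (simp add: algebra_simps assms(4))
  also have "\<dots> \<le> norm (u - a) * norm w + norm w * norm (u - a)"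
    by (intro norm_triangle_le_diff add_mono norm_mult_ineq)
  also have "\<dots> = 2 * norm (u - a)"
    by (simp add: norm_isometry[OF assms(2)])
  finally show ?thesis by simp
qed

text \<open>\<open>star_isomorphism\<close> does not ask for the unit to be preserved; this follows
  from surjectivity, since \<open>\<Phi> 1\<close> fixes \<open>\<Phi> y = 1\<close> under left
  multiplication.\<close>

lemma star_automorphism_one:
  assumes "star_automorphism \<Phi>"
  shows "\<Phi> 1 = 1"
proof -
  obtain y where y: "\<Phi> y = 1"
    using assms by (metis UNIV_I bij_betw_imp_surj_on imageE star_isomorphism_def)
  have "\<Phi> (1 * y) = \<Phi> 1 * \<Phi> y"
    using assms by (simp add: star_isomorphism_def del: mult_1)
  with y show ?thesis by simp
qed

lemma star_automorphism_minus:
  assumes "star_automorphism \<Phi>"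
  shows "\<Phi> (- x) = - \<Phi> x"
  using assms by (metis UNIV_I scaleC_minus1 star_isomorphism_def)

lemma generated_cstar_superset: "S \<subseteq> generated_cstar S"
  by (auto simp: generated_cstar_def)

section \<open>Products of spin flips as local operators\<close>

text \<open>A configuration is the set of its down spins, so flipping the spins in \<open>S\<close>
  turns \<open>s\<close> into \<open>symdiff s S\<close>.\<close>

definition symdiff :: "'e set \<Rightarrow> 'e set \<Rightarrow> 'e set" where
  "symdiff s t = (s - t) \<union> (t - s)"

lemma mem_symdiff: "x \<in> symdiff s t \<longleftrightarrow> (x \<in> s) \<noteq> (x \<in> t)"
  by (auto simp: symdiff_def)

lemma finite_symdiff: "finite s \<Longrightarrow> finite t \<Longrightarrow> finite (symdiff s t)"
  by (simp add: symdiff_def)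

lemma eq_symdiff_iff: "t = symdiff s S \<longleftrightarrow> s = symdiff t S"
  by (auto simp: set_eq_iff mem_symdiff)

text \<open>The product of the spin flips at the sites in \<open>S\<close>; the identity if \<open>S\<close> is infinite.\<close>

lift_definition flip :: "'e set \<Rightarrow> 'e local_op"
  is "\<lambda>S s t. if t = symdiff s (if finite S then S else {}) then 1 else 0"
proof -
  fix S :: "'e set"
  define S' where "S' = (if finite S then S else {})"
  have "on_sites S' (\<lambda>s t. if t = symdiff s S' then 1 else 0)"
    by (rule on_sitesI) (auto simp: set_eq_iff mem_symdiff)
  moreover have "finite S'" by (simp add: S'_def)
  ultimately show "\<exists>\<Lambda>. finite \<Lambda> \<and> on_sites \<Lambda>
      (\<lambda>s t. if t = symdiff s (if finite S then S else {}) then 1 else 0)"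
    unfolding S'_def by blast
qed

lemma kernel_flip: "finite S \<Longrightarrow> kernel (flip S) s t = (if t = symdiff s S then 1 else 0)"
  by (simp add: flip.rep_eq)

lemma kernel_flip_mult:
  assumes "finite S"
  shows "kernel (flip S * a) s t = kernel a (symdiff s S) t"
proof -
  have "{u. kernel (flip S) s u \<noteq> 0} = {symdiff s S}"
    by (auto simp: kernel_flip[OF assms])
  then show ?thesis
    by (simp add: times_local_op.rep_eq kmult_def) (simp add: kernel_flip[OF assms])
qed

lemma kernel_mult_flip:
  assumes "finite S"
  shows "kernel (a * flip S) s t = kernel a s (symdiff t S)"
proof -
  obtain \<Lambda> where \<Lambda>: "finite \<Lambda>" "on_sites \<Lambda> (kernel a)"
    using local_op_kernel by blast
  \<comment> \<open>\<open>nbhd \<Lambda> s\<close> contains the support of row \<open>s\<close> of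
    \<open>a\<close>; adding \<open>symdiff t S\<close> ensures that the only index where column
    \<open>t\<close> of the flip is nonzero lies in the range of summation.\<close>
  let ?A = "insert (symdiff t S) (nbhd \<Lambda> s)"
  have A: "finite ?A" using finite_nbhd[OF \<Lambda>(1)] by simp
  have "kernel (a * flip S) s t = (\<Sum>u\<in>?A. kernel a s u * kernel (flip S) u t)"
    unfolding times_local_op.rep_eq
    by (rule kmult_eq_sum[OF A]) (use row_subset[OF \<Lambda>(2), of s] in auto)
  also have "\<dots> = (\<Sum>u\<in>?A. if u = symdiff t S then kernel a s u else 0)"
    by (rule sum.cong) (auto simp: kernel_flip[OF assms] eq_symdiff_iff[of t])
  finally show ?thesis using A by simp
qed

lemma local_op_eqI: "(\<And>s t. kernel a s t = kernel b s t) \<Longrightarrow> a = b"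
  by (simp add: kernel_inject[symmetric] fun_eq_iff)

text \<open>Two flips of the same site cancel.\<close>

lemma flip_mult:
  assumes "finite S" "finite T"
  shows "flip S * flip T = flip (symdiff S T)"
  by (rule local_op_eqI)
     (auto simp: kernel_flip_mult kernel_flip assms finite_symdiff set_eq_iff mem_symdiff)

lemma flip_empty: "flip {} = 1"
  by (rule local_op_eqI) (auto simp: kernel_flip one_local_op.rep_eq kone_def symdiff_def)

lemma flip_adj_mult_self:
  assumes "finite S"
  shows "adj (flip S) * flip S = 1"
proof -
  have "adj (flip S) = flip S"
    by (rule local_op_eqI)
       (auto simp: adj_local_op.rep_eq kadj_def kernel_flip[OF assms] eq_symdiff_iff[of _ _ S])
  moreover have "symdiff S S = {}" by (simp add: symdiff_def)
  ultimately show ?thesis by (simp add: flip_mult[OF assms assms] flip_empty)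
qed

text \<open>The flip moves from one index of the kernel of \<open>a\<close> to the other: it does
  not change the restriction of a configuration to \<Lambda>, and outside \<Lambda> flipping
  \<open>s\<close> or flipping \<open>t\<close> gives the same equality test.\<close>

lemma flip_commute_disjoint:
  assumes "finite S" "on_sites \<Lambda> (kernel a)" "S \<inter> \<Lambda> = {}"
  shows "a * flip S = flip S * a"
proof (rule local_op_eqI)
  fix s t
  have *: "s - \<Lambda> = symdiff t S - \<Lambda> \<longleftrightarrow> symdiff s S - \<Lambda> = t - \<Lambda>"
    by (auto simp: set_eq_iff mem_symdiff)
  have **: "symdiff r S \<inter> \<Lambda> = r \<inter> \<Lambda>" for r
    using assms(3) by (auto simp: symdiff_def)
  obtain M where "kernel a = amplify \<Lambda> M"
    using assms(2) by (auto simp: on_sites_def)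
  then show "kernel (a * flip S) s t = kernel (flip S * a) s t"
    by (simp add: kernel_mult_flip kernel_flip_mult assms(1) amplify_def * **)
qed

section \<open>Commutation relations of the Pauli matrices\<close>

lemma site_op_pauli_x: "site_op e pauli_x = flip {e}"
  by (rule local_op_eqI)
     (auto simp: site_op.rep_eq kernel_flip amplify_def pauli_x_def set_eq_iff mem_symdiff)

text \<open>The sign of the diagonal matrix \<open>pauli_z\<close> records whether \<open>e\<close>
  is in the configuration, and the flip at \<open>e\<close> reverses this.\<close>

lemma flip_pauli_z_anticommute:
  "flip {e} * site_op e pauli_z = - (site_op e pauli_z * flip {e})"
proof (rule local_op_eqI)
  fix s t
  have *: "symdiff s {e} - {e} = t - {e} \<longleftrightarrow> s - {e} = symdiff t {e} - {e}"
    by (auto simp: set_eq_iff mem_symdiff)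
  show "kernel (flip {e} * site_op e pauli_z) s t = kernel (- (site_op e pauli_z * flip {e})) s t"
    by (simp add: kernel_flip_mult kernel_mult_flip uminus_local_op_def scaleC_local_op.rep_eq
        site_op.rep_eq amplify_def pauli_z_def mem_symdiff *)
qed

lemma flip_pauli_z_commute:
  assumes "e \<noteq> e'"
  shows "flip {e} * site_op e' pauli_z = site_op e' pauli_z * flip {e}"
  by (rule flip_commute_disjoint[of _ "{e'}", symmetric])
     (use assms in \<open>auto simp: site_op.rep_eq on_sites_amplify\<close>)

lemma completion_of_minus: "completion_of (- x) = - completion_of x"
  by (metis completion_of_scaleC scaleC_minus1)

lemma sigma_x_adj_mult_self: "adj (sigma_x e) * sigma_x e = 1"
  by (simp add: sigma_x_def site_op_pauli_x flip_adj_mult_self completion_of_one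
      flip: completion_of_adj completion_of_mult)

lemma sigma_x_sigma_z_anticommute: "sigma_x e * sigma_z e = - (sigma_z e * sigma_x e)"
  by (simp add: sigma_x_def sigma_z_def site_op_pauli_x flip_pauli_z_anticommute
      flip: completion_of_mult completion_of_minus)

lemma sigma_x_sigma_z_commute: "e \<noteq> e' \<Longrightarrow> sigma_x e * sigma_z e' = sigma_z e' * sigma_x e"
  by (simp add: sigma_x_def sigma_z_def site_op_pauli_x flip_pauli_z_commute
      flip: completion_of_mult)

section \<open>Star operators and coboundaries of vertex sets\<close>

lemma finite_star_edges: "finite (star_edges v)"
  by (cases v) (simp add: star_edges_eq)

text \<open>The four edges are distinct, so their iterated symmetric difference is the whole
  star.\<close>

lemma star_op_eq_flip: "star_op v = completion_of (flip (star_edges v))"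
proof (cases v)
  case (Pair x y)
  have "symdiff (symdiff (symdiff {Hor (x, y)} {Hor (x - 1, y)}) {Vert (x, y)}) {Vert (x, y - 1)}
      = star_edges v"
    by (auto simp: Pair star_edges_eq symdiff_def)
  then show ?thesis
    by (simp add: Pair sigma_x_def site_op_pauli_x flip_mult finite_symdiff
        flip: completion_of_mult)
qed

text \<open>The coboundary modulo 2 of the indicator function of \<open>V\<close>. In this parity
  form, adding a vertex amounts to a symmetric difference with its star.\<close>

definition coboundary :: "vertex set \<Rightarrow> edge set" where
  "coboundary V = {e. odd (card (endpoints e \<inter> V))}"

lemma card_endpoints: "card (endpoints e) = 2"
  by (cases e rule: endpoints.cases) auto

lemma finite_endpoints: "finite (endpoints e)"
  using card_endpoints[of e] card.infinite by fastforce

lemma coboundary_empty: "coboundary {} = {}"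
  by (simp add: coboundary_def)

lemma coboundary_insert:
  assumes "v \<notin> V"
  shows "coboundary (insert v V) = symdiff (star_edges v) (coboundary V)"
proof -
  have "odd (card (endpoints e \<inter> insert v V)) \<longleftrightarrow> (v \<in> endpoints e) \<noteq> odd (card (endpoints e \<inter> V))"
    for e
  proof (cases "v \<in> endpoints e")
    case True
    then have "endpoints e \<inter> insert v V = insert v (endpoints e \<inter> V)" by blast
    then show ?thesis using True assms finite_endpoints by simp
  qed simp
  then show ?thesis
    by (simp add: set_eq_iff mem_symdiff coboundary_def star_edges_def)
qed

lemma finite_coboundary: "finite V \<Longrightarrow> finite (coboundary V)"
  by (induction rule: finite_induct)
     (simp_all add: coboundary_empty coboundary_insert finite_symdiff finite_star_edges)

text \<open>An edge with both endpoints in \<open>V\<close> is counted twice, hence evenly.\<close>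

lemma coboundary_disjoint: "(\<And>e. e \<in> \<Lambda> \<Longrightarrow> endpoints e \<subseteq> V) \<Longrightarrow> coboundary V \<inter> \<Lambda> = {}"
  by (auto simp: coboundary_def Int_absorb2 card_endpoints)

text \<open>Iterated, this identifies the product of the star operators over \<open>V\<close> with
  the flip of \<open>coboundary V\<close>: flips of interior edges cancel in pairs.\<close>

lemma flip_coboundary_insert:
  assumes "finite V" "v \<notin> V"
  shows "completion_of (flip (coboundary (insert v V)))
    = star_op v * completion_of (flip (coboundary V))"
  by (simp add: star_op_eq_flip coboundary_insert[OF assms(2)] finite_star_edges
      finite_coboundary[OF assms(1)] flip: completion_of_mult flip_mult)

lemma commute_flip_coboundary:
  assumes "finite V" "\<And>v. v \<in> V \<Longrightarrow> u * star_op v = star_op v * u"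
  shows "u * completion_of (flip (coboundary V)) = completion_of (flip (coboundary V)) * u"
  using assms
proof (induction V rule: finite_induct)
  case empty
  then show ?case by (simp add: coboundary_empty flip_empty completion_of_one)
next
  case (insert v V)
  let ?w = "completion_of (flip (coboundary V))"
  have "u * (star_op v * ?w) = star_op v * (u * ?w)"
    using insert.prems[of v] by (simp flip: mult.assoc)
  also have "u * ?w = ?w * u" using insert by simp
  finally show ?case
    by (simp add: flip_coboundary_insert[OF insert.hyps] mult.assoc)
qed

section \<open>Impossibility of a single charge\<close>

lemma no_single_charge:
  assumes u: "adj u * u = 1"
    and anti: "u * star_op v0 = - (star_op v0 * u)"
    and comm: "\<And>v. v \<noteq> v0 \<Longrightarrow> u * star_op v = star_op v * u"
  shows False
proof -
  \<comment> \<open>Distance below 1 is what contradicts the lower bound of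
    \<open>anticommute_norm_diff\<close>.\<close>
  obtain a where a: "norm (completion_of a - u) < 1"
    using completion_of_dense[of 1 u] by auto
  obtain \<Lambda> where \<Lambda>: "finite \<Lambda>" "on_sites \<Lambda> (kernel a)"
    using local_op_kernel by blast
  \<comment> \<open>\<open>v0\<close> is removed and put back by \<open>insert\<close>, so that its
    star operator is split off as the only factor contributing a sign, whether or not
    \<open>v0\<close> is an endpoint of an edge in \<Lambda>.\<close>
  define V where "V = (\<Union>e\<in>\<Lambda>. endpoints e) - {v0}"
  have V: "finite V" "v0 \<notin> V"
    using \<Lambda>(1) finite_endpoints by (auto simp: V_def)
  let ?S = "coboundary (insert v0 V)"
  let ?w = "completion_of (flip ?S)" and ?w' = "completion_of (flip (coboundary V))"
  have S: "finite ?S" using V(1) by (simp add: finite_coboundary)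
  have "?S \<inter> \<Lambda> = {}" by (rule coboundary_disjoint) (auto simp: V_def)
  then have aw: "completion_of a * ?w = ?w * completion_of a"
    using flip_commute_disjoint[OF S \<Lambda>(2)] by (simp flip: completion_of_mult)
  have w: "adj ?w * ?w = 1"
    by (simp add: flip_adj_mult_self[OF S] completion_of_one flip: completion_of_adj completion_of_mult)
  have "u * (star_op v0 * ?w') = - (star_op v0 * (u * ?w'))"
    using anti by (simp flip: mult.assoc)
  also have "u * ?w' = ?w' * u"
    by (rule commute_flip_coboundary[OF V(1)], rule comm) (use V(2) in blast)
  finally have "u * ?w = - (?w * u)"
    by (simp add: flip_coboundary_insert[OF V] mult.assoc)
  from anticommute_norm_diff[OF u w this aw] a show False
    by (simp add: norm_minus_commute)
qed

theorem proposition4p8: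
  fixes \<alpha> :: "quasi_local \<Rightarrow> quasi_local"
  assumes "star_isomorphism toric_algebra diagonal_algebra \<alpha>"
    and "\<And>v. \<alpha> (star_op v) = sigma_z (upper_star_edge v)"
    and "\<And>f. \<alpha> (face_op f) = sigma_z (upper_face_edge f)"
  shows "\<not> (\<exists>\<Phi>. star_automorphism \<Phi> \<and> (\<forall>x\<in>toric_algebra. \<Phi> x = \<alpha> x))"
proof
  assume "\<exists>\<Phi>. star_automorphism \<Phi> \<and> (\<forall>x\<in>toric_algebra. \<Phi> x = \<alpha> x)"
  then obtain \<Phi> where \<Phi>: "star_automorphism \<Phi>" and ext: "\<forall>x\<in>toric_algebra. \<Phi> x = \<alpha> x"
    by blast
  have bij: "bij \<Phi>" and mult: "\<Phi> (x * y) = \<Phi> x * \<Phi> y" and adj: "\<Phi> (adj x) = adj (\<Phi> x)" for x y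
    using \<Phi> unfolding star_isomorphism_def by blast+
  note inj = bij_is_inj[OF bij, THEN injD]
  have star: "\<Phi> (star_op v) = sigma_z (upper_star_edge v)" for v
  proof -
    have "star_op v \<in> toric_algebra"
      unfolding toric_algebra_def by (rule subsetD[OF generated_cstar_superset]) simp
    then show ?thesis by (simp only: ext[rule_format] assms(2))
  qed
  define v0 :: vertex where "v0 = (0, 0)"
  \<comment> \<open>Here surjectivity onto the whole algebra is essential: \<alpha> alone only
    reaches the diagonal algebra.\<close>
  obtain u where u: "\<Phi> u = sigma_x (upper_star_edge v0)"
    using bij_is_surj[OF bij] by (metis surjD)
  show False
  proof (rule no_single_charge)
    show "adj u * u = 1"
      \<comment> \<open>Each relation for \<open>u\<close> is pulled back along the injective
        \<open>\<Phi>\<close> from a relation between Pauli matrices.\<close>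
      by (rule inj) (simp add: mult adj u sigma_x_adj_mult_self star_automorphism_one[OF \<Phi>])
    show "u * star_op v0 = - (star_op v0 * u)"
      by (rule inj)
         (simp add: mult u star star_automorphism_minus[OF \<Phi>] sigma_x_sigma_z_anticommute)
    show "u * star_op v = star_op v * u" if "v \<noteq> v0" for v
    proof (rule inj)
      \<comment> \<open>Different vertices have different upper edges, so the Pauli matrices sit at
        different sites and commute.\<close>
      have "upper_star_edge v0 \<noteq> upper_star_edge v"
        using that by (cases v) (auto simp: v0_def)
      then show "\<Phi> (u * star_op v) = \<Phi> (star_op v * u)"
        by (simp add: mult u star sigma_x_sigma_z_commute)
    qed
  qed
qed

end
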